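(* Let $0<q<1$, $\alpha\in\mathbb{R}$ with $|\alpha|>1$, $\lambda>0$, $j\in\mathbb{N}$, and let $\{\mathbb{H}_n(x;q)\}_{n\ge 0}$ be the $q$-Hermite I-Sobolev type polynomials. Then for every integer $n\ge 2$ the following identity of rational functions in $x$ holds: $$\Xi_{2,n}(x)\,\mathbb{H}_{n+1}(x;q)=\alpha_n(x)\,\mathbb{H}_n(x;q)+\beta_n(x)\,\mathbb{H}_{n-1}(x;q),$$ where $$\Xi_{2,n}(x)=\Xi_{1,n}(x)\,\mathcal{E}_{4,n+1}(x),$$ $$\alpha_n(x)=\Xi_{1,n+1}(x)\,\mathcal{E}_{8,n}(x)-\Xi_{1,n}(x)\,\mathcal{F}_{4,n+1}(x),\qquad \beta_n(x)=\Xi_{1,n+1}(x)\,\mathcal{F}_{8,n}(x).$$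
   Context: Here $\mathbb{N}=\{0,1,2,\dots\}$ and $0<q<1$. Notation: $[n]_q=\frac{1-q^n}{1-q}$, $[0]_q!=1$, $[n]_q!=[n]_q\cdots[1]_q$; $(a;q)_n=\prod_{i=0}^{n-1}(1-aq^i)$ (also for $n=\infty$), $(a_1,\dots,a_r;q)_n=\prod_i(a_i;q)_n$; $[n]_q^{(k)}=\frac{(q^{-n};q)_k}{(q-1)^k}q^{kn-\binom{k}{2}}$ (equal to $[n]_q[n-1]_q\cdots[n-k+1]_q$). The $q$-derivative is $D_qf(x)=\frac{f(qx)-f(x)}{(q-1)x}$ for $x\ne0$ (and $f'(0)$ at $x=0$), $D_q^0f=f$, $D_q^k=D_q D_q^{k-1}$; it acts on rational functions in $x$ by the same formula. The $q$-subtraction power is $(x\boxminus_q y)^m=\sum_{k=0}^m\frac{[m]_q!}{[k]_q![m-k]_q!}q^{\binom{k}{2}}(-y)^kx^{m-k}$ (equal to $\prod_{i=0}^{m-1}(x-q^iy)$). Monic $q$-Hermite I polynomials: $H_n(x;q)=q^{\binom n2}\sum_{k=0}^n\frac{(q^{-n};q)_k(x^{-1};q)_k}{(q;q)_k}(-qx)^k$ for $n\ge0$, and $H_m=0$ for $m<0$; equivalently $H_0=1$, $xH_n=H_{n+1}+\gamma_nH_{n-1}$ with $\gamma_n=q^{n-1}(1-q^n)$. Put $\|H_n\|^2=(1-q)(q;q)_n(q,-1,-q;q)_\infty q^{\binom n2}$ and $K_{n,q}^{(i,l)}(x,y)=\sum_{k=0}^n\frac{(D_q^iH_k)(x;q)\,(D_q^lH_k)(y;q)}{\|H_k\|^2}$.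 Sobolev inner product (on real polynomials): $\langle f,g\rangle_\lambda=\int_{-1}^1f(x)g(x)(qx,-qx;q)_\infty d_qx+\lambda (D_q^jf)(\alpha)(D_q^jg)(\alpha)$, where $\int_{-1}^1h(t)d_qt=(1-q)\sum_{m\ge0}q^m\big(h(q^m)+h(-q^m)\big)$. $\mathbb{H}_n(x;q)$ is the monic polynomial of degree $n$, $\{\mathbb{H}_n\}$ being orthogonal with respect to $\langle\cdot,\cdot\rangle_\lambda$. Put $\mathcal{A}_n^{(j)}(x,y)=\frac{[j]_q!}{\|H_{n-1}\|^2(x\boxminus_qy)^{j+1}}\sum_{k=0}^j\frac{(D_q^kH_{n-1})(y;q)}{[k]_q!}(x\boxminus_qy)^k$, $\mathcal{B}_n^{(j)}(x,y)=-\frac{[j]_q!}{\|H_{n-1}\|^2(x\boxminus_qy)^{j+1}}\sum_{k=0}^j\frac{(D_q^kH_{n})(y;q)}{[k]_q!}(x\boxminus_qy)^k$ $(n\ge1)$. With $D_q$ acting on $x$, for $n\ge2$: $\mathcal{C}_{1,n}(x,y)=D_q\mathcal{A}_n^{(j)}(x,y)-[n-1]_q\gamma_{n-1}^{-1}\mathcal{B}_n^{(j)}(qx,y)$, $\mathcal{D}_{1,n}(x,y)=[n]_q\mathcal{A}_n^{(j)}(qx,y)+[n-1]_q\gamma_{n-1}^{-1}x\,\mathcal{B}_n^{(j)}(qx,y)+D_q\mathcal{B}_n^{(j)}(x,y)$. With $c_n=\lambda\frac{[n]_q^{(j)}H_{n-j}(\alpha;q)}{1+\lambda K_{n-1,q}^{(j,j)}(\alpha,\alpha)}$: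 $\mathcal{E}_{1,n}(x)=1-c_n\mathcal{A}_n^{(j)}(x,\alpha)$, $\mathcal{F}_{1,n}(x)=-c_n\mathcal{B}_n^{(j)}(x,\alpha)$ $(n\ge1)$; and for $n\ge2$: $\mathcal{E}_{2,n}(x)=-\mathcal{F}_{1,n-1}(x)/\gamma_{n-1}$, $\mathcal{F}_{2,n}(x)=\mathcal{E}_{1,n-1}(x)-x\mathcal{E}_{2,n}(x)$; $\mathcal{E}_{3,n}(x)=-c_n\mathcal{C}_{1,n}(x,\alpha)$, $\mathcal{F}_{3,n}(x)=[n]_q-c_n\mathcal{D}_{1,n}(x,\alpha)$; $\Xi_{1,n}=\mathcal{E}_{1,n}\mathcal{F}_{2,n}-\mathcal{E}_{2,n}\mathcal{F}_{1,n}$; $\mathcal{E}_{4,n}=-(\mathcal{E}_{2,n}\mathcal{F}_{3,n}-\mathcal{E}_{3,n}\mathcal{F}_{2,n})$, $\mathcal{F}_{4,n}=\mathcal{E}_{1,n}\mathcal{F}_{3,n}-\mathcal{E}_{3,n}\mathcal{F}_{1,n}$; $\mathcal{E}_{7,n}(x)=x\mathcal{E}_{3,n+1}(x)+\mathcal{F}_{3,n+1}(x)$, $\mathcal{F}_{7,n}(x)=-\gamma_n\mathcal{E}_{3,n+1}(x)$; $\mathcal{E}_{8,n}=-(\mathcal{E}_{2,n}\mathcal{F}_{7,n}-\mathcal{E}_{7,n}\mathcal{F}_{2,n})$, $\mathcal{F}_{8,n}=\mathcal{E}_{1,n}\mathcal{F}_{7,n}-\mathcal{E}_{7,n}\mathcal{F}_{1,n}$.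 The functions $\alpha_n(x)$ are not to be confused with the constant $\alpha$. *)

theory Defs
  imports
    "HOL-Analysis.Analysis"
    "HOL-Computational_Algebra.Computational_Algebra"
begin

definition qnum :: "real \<Rightarrow> nat \<Rightarrow> real" where
  "qnum q n = (1 - q ^ n) / (1 - q)"

definition qfact :: "real \<Rightarrow> nat \<Rightarrow> real" where
  "qfact q n = (\<Prod>i=1..n. qnum q i)"

definition qpoch :: "real \<Rightarrow> real \<Rightarrow> nat \<Rightarrow> real" where
  "qpoch a q n = (\<Prod>i<n. 1 - a * q ^ i)"

definition qpoch_inf :: "real \<Rightarrow> real \<Rightarrow> real" where
  "qpoch_inf a q = (\<Prod>i. 1 - a * q ^ i)"

text \<open>Equal to \<open>[n]\<^sub>q [n - 1]\<^sub>q \<cdots> [n - k + 1]\<^sub>q\<close>; the exponent of the last factor may be negative.\<close>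

definition qfalling :: "real \<Rightarrow> nat \<Rightarrow> nat \<Rightarrow> real" where
  "qfalling q n k =
     qpoch (q powi (- int n)) q k / (q - 1) ^ k * q powi (int (k * n) - int (k choose 2))"

definition qderiv :: "real \<Rightarrow> (real \<Rightarrow> real) \<Rightarrow> real \<Rightarrow> real" where
  "qderiv q f x = (if x = 0 then deriv f 0 else (f (q * x) - f x) / ((q - 1) * x))"

definition qint :: "real \<Rightarrow> (real \<Rightarrow> real) \<Rightarrow> real" where
  "qint q h = (1 - q) * (\<Sum>m. q ^ m * (h (q ^ m) + h (- (q ^ m))))"

text \<open>Rational functions are elements of the field \<open>\<real>(x)\<close>, the type \<open>real poly fract\<close>.\<close>

abbreviation rconst :: "real \<Rightarrow> real poly fract" where
  "rconst c \<equiv> to_fract [:c:]"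

abbreviation rvar :: "real poly fract" where
  "rvar \<equiv> to_fract [:0, 1:]"

text \<open>The substitution of \<open>q x\<close> for \<open>x\<close>. For \<open>q \<noteq> 0\<close> it does not depend on the
  representation as a fraction; see \<open>rdilate_Fract\<close>.\<close>

definition rdilate :: "real \<Rightarrow> real poly fract \<Rightarrow> real poly fract" where
  "rdilate q f =
     (THE g. \<exists>a b. b \<noteq> 0 \<and> f = Fract a b \<and> g = Fract (pcompose a [:0, q:]) (pcompose b [:0, q:]))"

lemma rdilate_Fract:
  assumes "q \<noteq> 0" "b \<noteq> 0"
  shows "rdilate q (Fract a b) = Fract (pcompose a [:0, q:]) (pcompose b [:0, q:])"
  unfolding rdilate_def
proof (rule the_equality)
  show "\<exists>a' b'. b' \<noteq> 0 \<and> Fract a b = Fract a' b' \<and>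
      Fract (pcompose a [:0, q:]) (pcompose b [:0, q:]) =
      Fract (pcompose a' [:0, q:]) (pcompose b' [:0, q:])"
    using assms by blast
next
  fix g
  assume "\<exists>c d. d \<noteq> 0 \<and> Fract a b = Fract c d \<and>
      g = Fract (pcompose c [:0, q:]) (pcompose d [:0, q:])"
  then obtain c d where d: "d \<noteq> 0" and eq: "Fract a b = Fract c d"
    and g: "g = Fract (pcompose c [:0, q:]) (pcompose d [:0, q:])"
    by blast
  have "c * b = a * d" using eq d assms by (simp add: eq_fract)
  then have "pcompose c [:0, q:] * pcompose b [:0, q:] = pcompose a [:0, q:] * pcompose d [:0, q:]"
    by (metis pcompose_mult)
  moreover have "pcompose p [:0, q:] \<noteq> 0" if "p \<noteq> 0" for p :: "real poly"
    using that assms by (simp add: pcompose_eq_0_iff)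
  ultimately show "g = Fract (pcompose a [:0, q:]) (pcompose b [:0, q:])"
    using d assms by (simp add: g eq_fract)
qed

definition rqderiv :: "real \<Rightarrow> real poly fract \<Rightarrow> real poly fract" where
  "rqderiv q f = (rdilate q f - f) / (rconst (q - 1) * rvar)"

text \<open>The q-subtraction power of exponent \<open>m\<close>, as a polynomial in its first argument.\<close>

definition qsubpow :: "real \<Rightarrow> real \<Rightarrow> nat \<Rightarrow> real poly" where
  "qsubpow q y m =
     (\<Sum>k\<le>m. monom (qfact q m / (qfact q k * qfact q (m - k)) * q ^ (k choose 2) * (- y) ^ k) (m - k))"

text \<open>The factor \<open>(1/x; q)\<^sub>k x ^ k\<close> of the defining sum is the polynomial
  \<open>(x - 1) (x - q) \<cdots> (x - q ^ (k - 1))\<close>; see \<open>poly_hermiteI\<close> for the unreduced formula.\<close>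

definition hermiteI :: "real \<Rightarrow> int \<Rightarrow> real poly" where
  "hermiteI q m =
     (if m < 0 then 0 else
       smult (q ^ (nat m choose 2))
         (\<Sum>k\<le>nat m. smult (qpoch (q powi (- m)) q k / qpoch q q k * (- q) ^ k)
            (\<Prod>i<k. [:- (q ^ i), 1:])))"

lemma poly_hermiteI:
  assumes "x \<noteq> 0"
  shows "poly (hermiteI q (int n)) x =
    q ^ (n choose 2) *
      (\<Sum>k\<le>n. qpoch (q powi (- int n)) q k * qpoch (inverse x) q k / qpoch q q k * (- q * x) ^ k)"
proof -
  have "(\<Prod>i<k. x - q ^ i) = qpoch (inverse x) q k * x ^ k" for k
  proof -
    have "(\<Prod>i<k. x - q ^ i) = (\<Prod>i<k. (1 - inverse x * q ^ i) * x)"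
      using assms by (intro prod.cong) (auto simp: field_simps)
    also have "\<dots> = qpoch (inverse x) q k * x ^ k"
      by (simp only: prod.distrib qpoch_def) simp
    finally show ?thesis .
  qed
  moreover have "(- (q * x)) ^ k = (- q) ^ k * x ^ k" for k
    by (metis mult_minus_left power_mult_distrib)
  ultimately show ?thesis
    by (simp add: hermiteI_def poly_sum poly_prod mult_ac)
qed

definition hgamma :: "real \<Rightarrow> nat \<Rightarrow> real" where
  "hgamma q n = q powi (int n - 1) * (1 - q ^ n)"

definition hnorm2 :: "real \<Rightarrow> nat \<Rightarrow> real" where
  "hnorm2 q n = (1 - q) * qpoch q q n *
     (qpoch_inf q q * qpoch_inf (-1) q * qpoch_inf (- q) q) * q ^ (n choose 2)"

definition hderiv :: "real \<Rightarrow> nat \<Rightarrow> int \<Rightarrow> real \<Rightarrow> real" where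
  "hderiv q k m = (qderiv q ^^ k) (poly (hermiteI q m))"

definition hkernel :: "real \<Rightarrow> nat \<Rightarrow> nat \<Rightarrow> nat \<Rightarrow> real \<Rightarrow> real \<Rightarrow> real" where
  "hkernel q i l n x y = (\<Sum>k\<le>n. hderiv q i (int k) x * hderiv q l (int k) y / hnorm2 q k)"

definition sobolev_inner :: "real \<Rightarrow> real \<Rightarrow> real \<Rightarrow> nat \<Rightarrow> real poly \<Rightarrow> real poly \<Rightarrow> real" where
  "sobolev_inner q \<alpha> lam j f g =
     qint q (\<lambda>x. poly f x * poly g x * (qpoch_inf (q * x) q * qpoch_inf (- q * x) q))
     + lam * (qderiv q ^^ j) (poly f) \<alpha> * (qderiv q ^^ j) (poly g) \<alpha>"

definition sobolev_polys :: "real \<Rightarrow> real \<Rightarrow> real \<Rightarrow> nat \<Rightarrow> (nat \<Rightarrow> real poly) \<Rightarrow> bool" where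
  "sobolev_polys q \<alpha> lam j S \<longleftrightarrow>
     (\<forall>n. degree (S n) = n \<and> lead_coeff (S n) = 1) \<and>
     (\<forall>m n. m \<noteq> n \<longrightarrow> sobolev_inner q \<alpha> lam j (S m) (S n) = 0)"

text \<open>In \<open>calA\<close> to \<open>calD1\<close> the second argument \<open>y\<close> is a real number, and the
  value is a rational function of the first argument \<open>x\<close>.\<close>

definition calA :: "real \<Rightarrow> nat \<Rightarrow> nat \<Rightarrow> real \<Rightarrow> real poly fract" where
  "calA q j n y =
     rconst (qfact q j) / (rconst (hnorm2 q (n - 1)) * to_fract (qsubpow q y (j + 1))) *
     (\<Sum>k\<le>j. rconst (hderiv q k (int n - 1) y / qfact q k) * to_fract (qsubpow q y k))"

definition calB :: "real \<Rightarrow> nat \<Rightarrow> nat \<Rightarrow> real \<Rightarrow> real poly fract" where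
  "calB q j n y =
     - (rconst (qfact q j) / (rconst (hnorm2 q (n - 1)) * to_fract (qsubpow q y (j + 1)))) *
     (\<Sum>k\<le>j. rconst (hderiv q k (int n) y / qfact q k) * to_fract (qsubpow q y k))"

definition calC1 :: "real \<Rightarrow> nat \<Rightarrow> nat \<Rightarrow> real \<Rightarrow> real poly fract" where
  "calC1 q j n y =
     rqderiv q (calA q j n y)
     - rconst (qnum q (n - 1) / hgamma q (n - 1)) * rdilate q (calB q j n y)"

definition calD1 :: "real \<Rightarrow> nat \<Rightarrow> nat \<Rightarrow> real \<Rightarrow> real poly fract" where
  "calD1 q j n y =
     rconst (qnum q n) * rdilate q (calA q j n y)
     + rconst (qnum q (n - 1) / hgamma q (n - 1)) * rvar * rdilate q (calB q j n y)
     + rqderiv q (calB q j n y)"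

definition sobc :: "real \<Rightarrow> real \<Rightarrow> real \<Rightarrow> nat \<Rightarrow> nat \<Rightarrow> real" where
  "sobc q \<alpha> lam j n =
     lam * (qfalling q n j * poly (hermiteI q (int n - int j)) \<alpha>
            / (1 + lam * hkernel q j j (n - 1) \<alpha> \<alpha>))"

definition calE1 :: "real \<Rightarrow> real \<Rightarrow> real \<Rightarrow> nat \<Rightarrow> nat \<Rightarrow> real poly fract" where
  "calE1 q \<alpha> lam j n = 1 - rconst (sobc q \<alpha> lam j n) * calA q j n \<alpha>"

definition calF1 :: "real \<Rightarrow> real \<Rightarrow> real \<Rightarrow> nat \<Rightarrow> nat \<Rightarrow> real poly fract" where
  "calF1 q \<alpha> lam j n = - rconst (sobc q \<alpha> lam j n) * calB q j n \<alpha>"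

definition calE2 :: "real \<Rightarrow> real \<Rightarrow> real \<Rightarrow> nat \<Rightarrow> nat \<Rightarrow> real poly fract" where
  "calE2 q \<alpha> lam j n = - calF1 q \<alpha> lam j (n - 1) / rconst (hgamma q (n - 1))"

definition calF2 :: "real \<Rightarrow> real \<Rightarrow> real \<Rightarrow> nat \<Rightarrow> nat \<Rightarrow> real poly fract" where
  "calF2 q \<alpha> lam j n = calE1 q \<alpha> lam j (n - 1) - rvar * calE2 q \<alpha> lam j n"

definition calE3 :: "real \<Rightarrow> real \<Rightarrow> real \<Rightarrow> nat \<Rightarrow> nat \<Rightarrow> real poly fract" where
  "calE3 q \<alpha> lam j n = - rconst (sobc q \<alpha> lam j n) * calC1 q j n \<alpha>"

definition calF3 :: "real \<Rightarrow> real \<Rightarrow> real \<Rightarrow> nat \<Rightarrow> nat \<Rightarrow> real poly fract" where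
  "calF3 q \<alpha> lam j n = rconst (qnum q n) - rconst (sobc q \<alpha> lam j n) * calD1 q j n \<alpha>"

definition Xi1 :: "real \<Rightarrow> real \<Rightarrow> real \<Rightarrow> nat \<Rightarrow> nat \<Rightarrow> real poly fract" where
  "Xi1 q \<alpha> lam j n =
     calE1 q \<alpha> lam j n * calF2 q \<alpha> lam j n - calE2 q \<alpha> lam j n * calF1 q \<alpha> lam j n"

definition calE4 :: "real \<Rightarrow> real \<Rightarrow> real \<Rightarrow> nat \<Rightarrow> nat \<Rightarrow> real poly fract" where
  "calE4 q \<alpha> lam j n =
     - (calE2 q \<alpha> lam j n * calF3 q \<alpha> lam j n - calE3 q \<alpha> lam j n * calF2 q \<alpha> lam j n)"

definition calF4 :: "real \<Rightarrow> real \<Rightarrow> real \<Rightarrow> nat \<Rightarrow> nat \<Rightarrow> real poly fract" where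
  "calF4 q \<alpha> lam j n =
     calE1 q \<alpha> lam j n * calF3 q \<alpha> lam j n - calE3 q \<alpha> lam j n * calF1 q \<alpha> lam j n"

definition calE7 :: "real \<Rightarrow> real \<Rightarrow> real \<Rightarrow> nat \<Rightarrow> nat \<Rightarrow> real poly fract" where
  "calE7 q \<alpha> lam j n = rvar * calE3 q \<alpha> lam j (n + 1) + calF3 q \<alpha> lam j (n + 1)"

definition calF7 :: "real \<Rightarrow> real \<Rightarrow> real \<Rightarrow> nat \<Rightarrow> nat \<Rightarrow> real poly fract" where
  "calF7 q \<alpha> lam j n = - rconst (hgamma q n) * calE3 q \<alpha> lam j (n + 1)"

definition calE8 :: "real \<Rightarrow> real \<Rightarrow> real \<Rightarrow> nat \<Rightarrow> nat \<Rightarrow> real poly fract" where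
  "calE8 q \<alpha> lam j n =
     - (calE2 q \<alpha> lam j n * calF7 q \<alpha> lam j n - calE7 q \<alpha> lam j n * calF2 q \<alpha> lam j n)"

definition calF8 :: "real \<Rightarrow> real \<Rightarrow> real \<Rightarrow> nat \<Rightarrow> nat \<Rightarrow> real poly fract" where
  "calF8 q \<alpha> lam j n =
     calE1 q \<alpha> lam j n * calF7 q \<alpha> lam j n - calE7 q \<alpha> lam j n * calF1 q \<alpha> lam j n"

definition Xi2 :: "real \<Rightarrow> real \<Rightarrow> real \<Rightarrow> nat \<Rightarrow> nat \<Rightarrow> real poly fract" where
  "Xi2 q \<alpha> lam j n = Xi1 q \<alpha> lam j n * calE4 q \<alpha> lam j (n + 1)"

definition alpha_coeff :: "real \<Rightarrow> real \<Rightarrow> real \<Rightarrow> nat \<Rightarrow> nat \<Rightarrow> real poly fract" where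
  "alpha_coeff q \<alpha> lam j n =
     Xi1 q \<alpha> lam j (n + 1) * calE8 q \<alpha> lam j n - Xi1 q \<alpha> lam j n * calF4 q \<alpha> lam j (n + 1)"

definition beta_coeff :: "real \<Rightarrow> real \<Rightarrow> real \<Rightarrow> nat \<Rightarrow> nat \<Rightarrow> real poly fract" where
  "beta_coeff q \<alpha> lam j n = Xi1 q \<alpha> lam j (n + 1) * calF8 q \<alpha> lam j n"

end

theory Submission
  imports Defs
begin

text \<open>The Sobolev polynomials \<open>S\<^sub>n\<close> live in a plane.  Over the field of rational functions, each of
  \<open>S\<^sub>n\<close>, \<open>S\<^sub>n\<^sub>-\<^sub>1\<close>, \<open>D\<^sub>q S\<^sub>n\<close> and \<open>D\<^sub>q S\<^sub>n\<^sub>+\<^sub>1\<close> is a combination of the two consecutive q-Hermite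
  polynomials \<open>H\<^sub>n\<close> and \<open>H\<^sub>n\<^sub>-\<^sub>1\<close>.  By Cramer's rule, \<open>\<Xi>\<^sub>1\<^sub>,\<^sub>n D\<^sub>q S\<^sub>n\<close> and \<open>\<Xi>\<^sub>1\<^sub>,\<^sub>n D\<^sub>q S\<^sub>n\<^sub>+\<^sub>1\<close> are then
  combinations of \<open>S\<^sub>n\<close> and \<open>S\<^sub>n\<^sub>-\<^sub>1\<close> (\<open>ladder_down\<close>, \<open>ladder_up\<close>).  The first formula at \<open>n + 1\<close> and
  the second at \<open>n\<close> both involve \<open>D\<^sub>q S\<^sub>n\<^sub>+\<^sub>1\<close>; eliminating it gives the recurrence.

  The substance is the first of these combinations, \<open>S\<^sub>n = H\<^sub>n - c\<^sub>n (\<A>\<^sub>n H\<^sub>n + \<B>\<^sub>n H\<^sub>n\<^sub>-\<^sub>1)\<close>; the others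
  follow from it by the recurrence \<open>x H\<^sub>n = H\<^sub>n\<^sub>+\<^sub>1 + \<gamma>\<^sub>n H\<^sub>n\<^sub>-\<^sub>1\<close>, the lowering rule
  \<open>D\<^sub>q H\<^sub>n = [n]\<^sub>q H\<^sub>n\<^sub>-\<^sub>1\<close> and the q-product rule.  It has two halves.  Orthogonality of \<open>S\<^sub>n\<close> to all
  polynomials of lower degree, expanded in the \<open>H\<^sub>k\<close>, gives
  \<open>S\<^sub>n = H\<^sub>n - c\<^sub>n K\<close> with \<open>K\<close> the kernel polynomial (\<open>sobolev_poly_eq_kernel\<close>).  The
  Christoffel-Darboux formula writes \<open>(x - y)\<close> times the kernel through \<open>H\<^sub>n\<close> and \<open>H\<^sub>n\<^sub>-\<^sub>1\<close>, and a
  q-Leibniz formula moves \<open>D\<^sub>q\<^sup>j\<close> in \<open>y\<close> past the factor \<open>x - y\<close>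
  (\<open>kernel_poly_eq_calA_calB\<close>).

  The first half needs the orthogonality of the \<open>H\<^sub>n\<close> with their exact norms.  These come from
  integration by parts, \<open>\<integral> x f w = (1 - q) \<integral> (D\<^sub>q f) w\<close> (\<open>hermite_integral_var_mult\<close>): together
  with the recurrence it makes the integral of each \<open>H\<^sub>n\<close> with \<open>n \<ge> 1\<close> vanish, whence orthogonality
  as in Favard's theorem, and applied to even powers of \<open>x\<close> it determines the total mass.\<close>

section \<open>The q-derivative of polynomials\<close>

text \<open>For \<open>q \<noteq> 1\<close> the division is exact, because the numerator vanishes at \<open>0\<close>.\<close>

definition poly_qderiv :: "real \<Rightarrow> real poly \<Rightarrow> real poly" where
  "poly_qderiv q p = (pcompose p [:0, q:] - p) div [:0, q - 1:]"

lemma poly_qderiv_mult_var: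
  assumes "q \<noteq> 1"
  shows "[:0, q - 1:] * poly_qderiv q p = pcompose p [:0, q:] - p"
proof -
  have "[:0, 1:] dvd pcompose p [:0, q:] - p"
    using poly_eq_0_iff_dvd[of "pcompose p [:0, q:] - p" 0] by (simp add: poly_pcompose)
  moreover have "[:0, q - 1:] = smult (q - 1) [:0, 1:]"
    by simp
  ultimately have "[:0, q - 1:] dvd pcompose p [:0, q:] - p"
    using assms by (simp only: smult_dvd_iff) simp
  then show ?thesis
    unfolding poly_qderiv_def by (rule dvd_mult_div_cancel)
qed

lemma poly_qderiv_eqI:
  assumes "q \<noteq> 1" "[:0, q - 1:] * d = pcompose p [:0, q:] - p"
  shows "poly_qderiv q p = d"
proof -
  have "[:0, q - 1:] * poly_qderiv q p = [:0, q - 1:] * d"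
    by (simp only: poly_qderiv_mult_var[OF assms(1)] assms(2))
  then show ?thesis
    using assms(1) by (metis mult_left_cancel pCons_eq_0_iff right_minus_eq)
qed

lemma poly_qderiv_0: "poly_qderiv q 0 = 0"
  by (simp add: poly_qderiv_def)

lemma poly_qderiv_const: "poly_qderiv q [:c:] = 0"
  by (simp add: poly_qderiv_def)

lemma poly_qderiv_add:
  assumes "q \<noteq> 1"
  shows "poly_qderiv q (p + r) = poly_qderiv q p + poly_qderiv q r"
  by (rule poly_qderiv_eqI[OF assms])
    (simp only: distrib_left poly_qderiv_mult_var[OF assms] pcompose_add)

lemma poly_qderiv_smult:
  assumes "q \<noteq> 1"
  shows "poly_qderiv q (smult c p) = smult c (poly_qderiv q p)"
  by (rule poly_qderiv_eqI[OF assms])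
    (simp only: mult_smult_right poly_qderiv_mult_var[OF assms] pcompose_smult smult_diff_right)

lemma poly_qderiv_diff:
  assumes "q \<noteq> 1"
  shows "poly_qderiv q (p - r) = poly_qderiv q p - poly_qderiv q r"
  by (rule poly_qderiv_eqI[OF assms])
    (simp only: right_diff_distrib poly_qderiv_mult_var[OF assms] pcompose_diff)

lemma smult_sum_right: "smult c (sum f A) = (\<Sum>k\<in>A. smult c (f k))"
  by (induction A rule: infinite_finite_induct) (simp_all add: smult_add_right)

lemma poly_qderiv_sum:
  assumes "q \<noteq> 1"
  shows "poly_qderiv q (sum f A) = (\<Sum>k\<in>A. poly_qderiv q (f k))"
  by (induction A rule: infinite_finite_induct)
    (use assms in \<open>simp_all add: poly_qderiv_0 poly_qderiv_add\<close>)

lemma poly_qderiv_mult: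
  assumes "q \<noteq> 1"
  shows "poly_qderiv q (p * r) = poly_qderiv q p * r + pcompose p [:0, q:] * poly_qderiv q r"
proof (rule poly_qderiv_eqI[OF assms])
  let ?d = "[:0, q - 1:]"
  have "?d * (poly_qderiv q p * r + pcompose p [:0, q:] * poly_qderiv q r)
      = (?d * poly_qderiv q p) * r + pcompose p [:0, q:] * (?d * poly_qderiv q r)"
    by (simp only: distrib_left mult.assoc mult.left_commute)
  also have "\<dots> = pcompose (p * r) [:0, q:] - p * r"
    by (simp only: poly_qderiv_mult_var[OF assms] pcompose_mult) (simp add: algebra_simps)
  finally show "?d * (poly_qderiv q p * r + pcompose p [:0, q:] * poly_qderiv q r)
      = pcompose (p * r) [:0, q:] - p * r" .
qed

text \<open>Multiplication by \<open>x\<close> and the q-derivative satisfy a q-deformed Weyl relation.\<close>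

lemma poly_qderiv_var_mult:
  assumes "q \<noteq> 1"
  shows "poly_qderiv q ([:0, 1:] * p) = p + smult q ([:0, 1:] * poly_qderiv q p)"
proof -
  have "poly_qderiv q [:0, 1:] = 1"
    by (rule poly_qderiv_eqI) (use assms in \<open>simp_all add: pcompose_pCons\<close>)
  then show ?thesis
    unfolding poly_qderiv_mult[OF assms] by (simp add: pcompose_pCons)
qed

lemma poly_poly_qderiv:
  assumes "q \<noteq> 1" "x \<noteq> 0"
  shows "poly (poly_qderiv q p) x = (poly p (q * x) - poly p x) / ((q - 1) * x)"
proof -
  have "poly ([:0, q - 1:] * poly_qderiv q p) x = poly p (q * x) - poly p x"
    by (simp only: poly_qderiv_mult_var[OF assms(1)]) (simp add: poly_pcompose mult.commute)
  then show ?thesis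
    using assms by (simp add: field_simps)
qed

lemma qderiv_poly:
  assumes "q \<noteq> 1"
  shows "qderiv q (poly p) = poly (poly_qderiv q p)"
proof
  fix x
  show "qderiv q (poly p) x = poly (poly_qderiv q p) x"
  proof (cases "x = 0")
    case True
    have "coeff ([:0, q - 1:] * poly_qderiv q p) 1 = coeff (pcompose p [:0, q:] - p) 1"
      by (simp only: poly_qderiv_mult_var[OF assms])
    then have "(q - 1) * coeff (poly_qderiv q p) 0 = (q - 1) * coeff p 1"
      by (simp add: coeff_pcompose_linear algebra_simps)
    then have "coeff (poly_qderiv q p) 0 = coeff p 1"
      using assms by simp
    moreover have "deriv (poly p) 0 = coeff p 1"
      by (simp add: DERIV_imp_deriv[OF poly_DERIV] poly_0_coeff_0 coeff_pderiv)
    ultimately show ?thesis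
      using True by (simp add: qderiv_def poly_0_coeff_0)
  qed (use assms in \<open>simp add: qderiv_def poly_poly_qderiv\<close>)
qed

lemma qderiv_funpow_poly:
  assumes "q \<noteq> 1"
  shows "(qderiv q ^^ k) (poly p) = poly ((poly_qderiv q ^^ k) p)"
  by (induction k) (simp_all add: qderiv_poly[OF assms])

lemma poly_qderiv_funpow_linear:
  assumes "q \<noteq> 1"
  shows "(poly_qderiv q ^^ k) (p + r) = (poly_qderiv q ^^ k) p + (poly_qderiv q ^^ k) r"
    and "(poly_qderiv q ^^ k) (p - r) = (poly_qderiv q ^^ k) p - (poly_qderiv q ^^ k) r"
    and "(poly_qderiv q ^^ k) (smult c p) = smult c ((poly_qderiv q ^^ k) p)"
  by (induction k)
    (simp_all add: poly_qderiv_add poly_qderiv_diff poly_qderiv_smult assms)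

lemma poly_qderiv_funpow_sum:
  assumes "q \<noteq> 1"
  shows "(poly_qderiv q ^^ k) (sum f A) = (\<Sum>i\<in>A. (poly_qderiv q ^^ k) (f i))"
  by (induction k) (simp_all add: poly_qderiv_sum assms)

text \<open>A polynomial with vanishing q-derivative is constant: \<open>p(q x) = p(x)\<close> forces the factor
  \<open>q ^ i - 1\<close> to annihilate the coefficient of \<open>x ^ i\<close>.  Below, this turns identities between
  polynomials into inductions on the degree, with one evaluation to fix the constant.\<close>

lemma poly_qderiv_eq_0_imp_eq_0:
  assumes "0 < q" "q < 1" "poly_qderiv q p = 0" "poly p a = 0"
  shows "p = 0"
proof -
  have "pcompose p [:0, q:] - p = 0"
    using poly_qderiv_mult_var[of q p] assms by simp
  then have "q ^ i * coeff p i = coeff p i" for i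
    by (metis coeff_pcompose_linear right_minus_eq)
  moreover have "q ^ Suc i < 1" for i
    using assms(1,2) by (intro power_Suc_less_one) auto
  ultimately have "coeff p (Suc i) = 0" for i
    by (metis less_irrefl mult_cancel_right1)
  then have "p = [:coeff p 0:]"
    by (intro poly_eqI) (simp add: coeff_pCons split: nat.split)
  then show ?thesis
    using assms(4) by (metis mult_zero_right pCons_0_0 poly_0 poly_pCons add.right_neutral)
qed

lemma qnum_0 [simp]: "qnum q 0 = 0"
  by (simp add: qnum_def)

lemma qnum_Suc: "q \<noteq> 1 \<Longrightarrow> qnum q (Suc n) = 1 + q * qnum q n"
  by (simp add: qnum_def field_simps)

lemma qnum_mult: "q \<noteq> 1 \<Longrightarrow> (1 - q) * qnum q n = 1 - q ^ n"
  by (simp add: qnum_def)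

lemma qnum_pos:
  assumes "0 < q" "q < 1" "n > 0"
  shows "qnum q n > 0"
  using assms by (simp add: qnum_def power_less_one_iff)

lemma qfact_Suc: "qfact q (Suc n) = qnum q (Suc n) * qfact q n"
  by (simp add: qfact_def)

lemma qfact_0 [simp]: "qfact q 0 = 1"
  by (simp add: qfact_def)

lemma qfact_pos: "0 < q \<Longrightarrow> q < 1 \<Longrightarrow> qfact q n > 0"
  unfolding qfact_def by (intro prod_pos) (auto intro: qnum_pos)

section \<open>The q-subtraction power\<close>

text \<open>Dilating \<open>(x - y)(x - q y) \<cdots> (x - q ^ (m - 1) y)\<close> by \<open>q\<close> shifts the zeros by one place, so
  the difference quotient keeps all the factors but the last.\<close>

lemma poly_qderiv_prod_shifted:
  assumes "q \<noteq> 1" "q \<noteq> 0"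
  shows "poly_qderiv q (\<Prod>i<Suc m. [:- (q ^ i * y), 1:])
    = smult (qnum q (Suc m)) (\<Prod>i<m. [:- (q ^ i * y), 1:])"
proof (rule poly_qderiv_eqI[OF assms(1)])
  let ?P = "\<Prod>i<m. [:- (q ^ i * y), 1:]"
  have "pcompose (\<Prod>i<Suc m. [:- (q ^ i * y), 1:]) [:0, q:]
      = (\<Prod>i<Suc m. [:- (q ^ i * y), q:])"
    by (simp only: pcompose_prod) (simp add: pcompose_pCons)
  also have "\<dots> = [:- y, q:] * (\<Prod>i<m. [:- (q ^ Suc i * y), q:])"
    by (subst prod.lessThan_Suc_shift) simp
  also have "(\<Prod>i<m. [:- (q ^ Suc i * y), q:]) = (\<Prod>i<m. [:q:] * [:- (q ^ i * y), 1:])"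
    by (intro prod.cong) simp_all
  also have "\<dots> = [:q ^ m:] * ?P"
    by (simp only: prod.distrib) (simp add: poly_const_pow)
  finally have dil: "pcompose (\<Prod>i<Suc m. [:- (q ^ i * y), 1:]) [:0, q:]
      = [:- y, q:] * ([:q ^ m:] * ?P)" .
  have "[:0, q - 1:] * [:qnum q (Suc m):] = [:- y, q:] * [:q ^ m:] - [:- (q ^ m * y), 1:]"
    using assms(1) by (simp add: qnum_def field_simps)
  then have "[:0, q - 1:] * [:qnum q (Suc m):] * ?P
      = ([:- y, q:] * [:q ^ m:] - [:- (q ^ m * y), 1:]) * ?P"
    by (simp only:)
  also have "\<dots> = [:- y, q:] * ([:q ^ m:] * ?P) - ?P * [:- (q ^ m * y), 1:]"
    by (simp only: left_diff_distrib right_diff_distrib mult_ac)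
  finally have "[:0, q - 1:] * [:qnum q (Suc m):] * ?P
      = [:- y, q:] * ([:q ^ m:] * ?P) - ?P * [:- (q ^ m * y), 1:]" .
  moreover have "[:0, q - 1:] * smult (qnum q (Suc m)) ?P = [:0, q - 1:] * [:qnum q (Suc m):] * ?P"
    by simp
  ultimately show "[:0, q - 1:] * smult (qnum q (Suc m)) ?P
      = pcompose (\<Prod>i<Suc m. [:- (q ^ i * y), 1:]) [:0, q:] - (\<Prod>i<Suc m. [:- (q ^ i * y), 1:])"
    unfolding dil by (simp only: prod.lessThan_Suc)
qed

lemma poly_qderiv_monom:
  assumes "q \<noteq> 1"
  shows "poly_qderiv q (monom c (Suc n)) = monom (qnum q (Suc n) * c) n"
  by (rule poly_qderiv_eqI[OF assms], rule poly_eqI)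
    (use assms in \<open>auto simp: coeff_pcompose_linear coeff_pCons qnum_def field_simps split: nat.splits\<close>)

lemma poly_qderiv_qsubpow:
  assumes "0 < q" "q < 1"
  shows "poly_qderiv q (qsubpow q y (Suc m)) = smult (qnum q (Suc m)) (qsubpow q y m)"
proof -
  define c where "c n k = qfact q n / (qfact q k * qfact q (n - k)) * q ^ (k choose 2) * (- y) ^ k"
    for n k
  have Q: "q \<noteq> 1"
    using assms by simp
  have "poly_qderiv q (qsubpow q y (Suc m)) = (\<Sum>k\<le>Suc m. poly_qderiv q (monom (c (Suc m) k) (Suc m - k)))"
    by (simp only: qsubpow_def c_def poly_qderiv_sum[OF Q])
  also have "\<dots> = (\<Sum>k\<le>m. poly_qderiv q (monom (c (Suc m) k) (Suc m - k)))"
    by (simp add: monom_0 poly_qderiv_const)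
  also have "\<dots> = (\<Sum>k\<le>m. smult (qnum q (Suc m)) (monom (c m k) (m - k)))"
  proof (rule sum.cong[OF refl])
    fix k assume "k \<in> {..m}"
    then have k: "Suc m - k = Suc (m - k)"
      by auto
    have "qnum q (Suc (m - k)) \<noteq> 0"
      using qnum_pos[OF assms, of "Suc (m - k)"] by simp
    then have "qnum q (Suc (m - k)) * c (Suc m) k = qnum q (Suc m) * c m k"
      by (simp add: c_def k qfact_Suc)
    then show "poly_qderiv q (monom (c (Suc m) k) (Suc m - k)) = smult (qnum q (Suc m)) (monom (c m k) (m - k))"
      by (simp only: k poly_qderiv_monom[OF Q] smult_monom)
  qed
  also have "\<dots> = smult (qnum q (Suc m)) (qsubpow q y m)"
    by (simp only: qsubpow_def c_def smult_sum_right)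
  finally show ?thesis .
qed

text \<open>The Gauss binomial formula: both sides have the same q-derivative up to the induction
  hypothesis, and the same value at \<open>0\<close>.\<close>

lemma qsubpow_eq_prod:
  assumes "0 < q" "q < 1"
  shows "qsubpow q y m = (\<Prod>i<m. [:- (q ^ i * y), 1:])"
proof (induction m)
  case 0
  show ?case
    by (simp add: qsubpow_def numeral_2_eq_2)
next
  case (Suc m)
  have Q: "q \<noteq> 1" "q \<noteq> 0"
    using assms by auto
  have P0: "(\<Prod>i<n. - (q ^ i * y)) = q ^ (n choose 2) * (- y) ^ n" for n
    by (induction n) (simp_all add: numeral_2_eq_2 power_add)
  have S0: "poly (qsubpow q y n) 0 = q ^ (n choose 2) * (- y) ^ n" for n
  proof -
    have "poly (qsubpow q y n) 0 = coeff (qsubpow q y n) 0"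
      by (simp add: poly_0_coeff_0)
    also have "\<dots> = (\<Sum>k\<le>n. if k = n then q ^ (n choose 2) * (- y) ^ n else 0)"
      unfolding qsubpow_def coeff_sum coeff_monom
      by (rule sum.cong) (use qfact_pos[OF assms, of n] in auto)
    finally show ?thesis
      by simp
  qed
  have "poly_qderiv q (qsubpow q y (Suc m) - (\<Prod>i<Suc m. [:- (q ^ i * y), 1:])) = 0"
    by (simp only: poly_qderiv_diff[OF Q(1)] poly_qderiv_qsubpow[OF assms]
        poly_qderiv_prod_shifted[OF Q] Suc diff_self)
  moreover have "poly (qsubpow q y (Suc m) - (\<Prod>i<Suc m. [:- (q ^ i * y), 1:])) 0 = 0"
    by (simp only: poly_diff S0 poly_prod poly_pCons mult_zero_left add.right_neutral P0)
  ultimately have "qsubpow q y (Suc m) - (\<Prod>i<Suc m. [:- (q ^ i * y), 1:]) = 0"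
    by (rule poly_qderiv_eq_0_imp_eq_0[OF assms])
  then show ?case
    by simp
qed

lemma qsubpow_Suc:
  assumes "0 < q" "q < 1"
  shows "qsubpow q y (Suc m) = qsubpow q y m * [:- (q ^ m * y), 1:]"
  by (simp only: qsubpow_eq_prod[OF assms] prod.lessThan_Suc)

lemma qsubpow_0: "qsubpow q y 0 = 1"
  by (simp add: qsubpow_def numeral_2_eq_2)

lemma qsubpow_nonzero:
  assumes "0 < q" "q < 1"
  shows "qsubpow q y m \<noteq> 0"
  unfolding qsubpow_eq_prod[OF assms] by simp

section \<open>The q-derivative of rational functions\<close>

lemma rdilate_to_fract:
  "q \<noteq> 0 \<Longrightarrow> rdilate q (to_fract p) = to_fract (pcompose p [:0, q:])"
  by (simp add: to_fract_def rdilate_Fract pcompose_1)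

lemma rdilate_mult:
  assumes "q \<noteq> 0"
  shows "rdilate q (f * g) = rdilate q f * rdilate q g"
  by (cases f; cases g) (use assms in \<open>simp add: rdilate_Fract pcompose_mult\<close>)

lemma rdilate_add:
  assumes "q \<noteq> 0"
  shows "rdilate q (f + g) = rdilate q f + rdilate q g"
  by (cases f; cases g)
    (use assms in \<open>simp add: rdilate_Fract pcompose_mult pcompose_add pcompose_eq_0_iff\<close>)

lemma rqderiv_add:
  "q \<noteq> 0 \<Longrightarrow> rqderiv q (f + g) = rqderiv q f + rqderiv q g"
  by (simp add: rqderiv_def rdilate_add flip: add_divide_distrib)

lemma rqderiv_mult:
  "q \<noteq> 0 \<Longrightarrow> rqderiv q (f * g) = rqderiv q f * g + rdilate q f * rqderiv q g"
  by (simp add: rqderiv_def rdilate_mult diff_divide_distrib algebra_simps)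

lemma rqderiv_to_fract:
  assumes "q \<noteq> 0" "q \<noteq> 1"
  shows "rqderiv q (to_fract p) = to_fract (poly_qderiv q p)"
proof -
  have "to_fract (pcompose p [:0, q:]) - to_fract p = to_fract ([:0, q - 1:] * poly_qderiv q p)"
    by (simp only: poly_qderiv_mult_var[OF assms(2)] to_fract_diff)
  also have "[:0, q - 1:] = [:q - 1:] * [:0, 1:]"
    by simp
  finally have "to_fract (pcompose p [:0, q:]) - to_fract p
      = rconst (q - 1) * rvar * to_fract (poly_qderiv q p)"
    by (simp only: to_fract_mult)
  moreover have "rconst (q - 1) * rvar \<noteq> 0"
    using assms(2) by simp
  ultimately show ?thesis
    unfolding rqderiv_def rdilate_to_fract[OF assms(1)] by simp
qed

lemma rqderiv_rconst_mult:
  assumes "q \<noteq> 0"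
  shows "rqderiv q (rconst c * f) = rconst c * rqderiv q f"
  using assms by (simp add: rqderiv_mult) (simp add: rqderiv_def rdilate_to_fract)

section \<open>q-Hermite polynomials\<close>

lemma hermiteI_neg: "m < 0 \<Longrightarrow> hermiteI q m = 0"
  by (simp add: hermiteI_def)

lemma hermiteI_0: "hermiteI q 0 = 1"
  by (simp add: hermiteI_def qpoch_def numeral_2_eq_2)

text \<open>At \<open>1\<close> only the term with index \<open>0\<close> of the defining sum survives, since \<open>x - 1\<close> divides the
  others.\<close>

lemma poly_hermiteI_1: "poly (hermiteI q (int n)) 1 = q ^ (n choose 2)"
proof -
  have "(\<Prod>i<k. 1 - q ^ i) = (if k = 0 then 1 else 0)" for k
    by (induction k) auto
  then have *: "(\<Sum>k\<le>n. c k * (\<Prod>i<k. 1 - q ^ i)) = (\<Sum>k\<le>n. if k = 0 then c 0 else 0)"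
    for c :: "nat \<Rightarrow> real"
    by (intro sum.cong) (simp_all only: split: if_split, simp_all)
  have "poly (hermiteI q (int n)) 1 = q ^ (n choose 2)
      * (\<Sum>k\<le>n. (qpoch (q powi (- int n)) q k / qpoch q q k * (- q) ^ k) * (\<Prod>i<k. 1 - q ^ i))"
    by (simp add: hermiteI_def poly_sum poly_prod)
  also have "\<dots> = q ^ (n choose 2)"
    by (simp only: *) (simp add: qpoch_def)
  finally show ?thesis .
qed

lemma qpoch_Suc: "qpoch a q (Suc k) = qpoch a q k * (1 - a * q ^ k)"
  by (simp add: qpoch_def)

lemma qpoch_Suc_shift: "qpoch a q (Suc k) = (1 - a) * qpoch (a * q) q k"
  unfolding qpoch_def by (subst prod.lessThan_Suc_shift) (simp add: mult.assoc)

lemma qpoch_pos: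
  assumes "0 < q" "q < 1" "a < 1"
  shows "qpoch a q n > 0"
  unfolding qpoch_def
proof (rule prod_pos)
  fix i
  have "a * q ^ i < 1"
  proof (cases "a \<ge> 0")
    case True
    then have "a * q ^ i \<le> a * 1"
      using assms by (intro mult_left_mono power_le_one) auto
    then show ?thesis
      using assms by simp
  next
    case False
    then have "a * q ^ i \<le> 0"
      using assms by (intro mult_nonpos_nonneg) auto
    then show ?thesis
      by simp
  qed
  then show "0 < 1 - a * q ^ i"
    by simp
qed

text \<open>Lowering: the q-derivative maps \<open>\<Prod>i<k. x - q ^ i\<close> to a multiple of \<open>\<Prod>i<k-1. x - q ^ i\<close>,
  and the q-Pochhammer coefficients of the defining sum match after this shift of the index.\<close>

lemma poly_qderiv_hermiteI:
  assumes "0 < q" "q < 1"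
  shows "poly_qderiv q (hermiteI q (int n)) = smult (qnum q n) (hermiteI q (int n - 1))"
proof (cases n)
  case 0
  then show ?thesis
    using poly_qderiv_const[of q 1] by (simp add: hermiteI_0 one_pCons)
next
  case (Suc m)
  have Q: "q \<noteq> 1" "q \<noteq> 0"
    using assms by auto
  define c where "c n k = qpoch (q powi (- int n)) q k / qpoch q q k * (- q) ^ k" for n k
  define \<phi> where "\<phi> k = (\<Prod>i<k. [:- (q ^ i), 1:])" for k
  have H: "hermiteI q (int n) = smult (q ^ (n choose 2)) (\<Sum>k\<le>n. smult (c n k) (\<phi> k))" for n
    by (simp add: hermiteI_def c_def \<phi>_def)
  have \<phi>0: "poly_qderiv q (\<phi> 0) = 0"
    using poly_qderiv_const[of q 1] by (simp add: \<phi>_def one_pCons)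
  have \<phi>: "poly_qderiv q (\<phi> (Suc k)) = smult (qnum q (Suc k)) (\<phi> k)" for k
    using poly_qderiv_prod_shifted[OF Q, of 1 k] by (simp only: \<phi>_def mult_1_right)
  have coeff: "q ^ (Suc m choose 2) * (c (Suc m) (Suc k) * qnum q (Suc k))
      = qnum q (Suc m) * (q ^ (m choose 2) * c m k)" for k
  proof -
    have a: "q powi (- int (Suc m)) * q = q powi (- int m)"
      using Q(2) unfolding power_int_minus power_int_of_nat by (simp add: field_simps)
    have b: "q ^ m * ((1 - q powi (- int (Suc m))) * (- q)) = 1 - q ^ Suc m"
      using Q(2) unfolding power_int_minus power_int_of_nat by (simp add: field_simps)
    have nz: "qpoch q q k \<noteq> 0" "1 - q * q ^ k \<noteq> 0"
      using qpoch_pos[OF assms assms(2), of k] qnum_pos[OF assms, of "Suc k"] 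
      by (auto simp: qnum_def)
    have *: "a * P / (Q * w) * (e * (- q)) * (w / z) = a * (- q) * (P / Q * e) / z"
      if "Q \<noteq> 0" "w \<noteq> 0" for a P Q e w z :: real
      using that by (simp add: field_simps)
    have c: "c (Suc m) (Suc k) * qnum q (Suc k)
        = (1 - q powi (- int (Suc m))) * (- q) * c m k / (1 - q)"
      unfolding c_def qpoch_Suc_shift[of "q powi (- int (Suc m))"] a
      using *[OF nz]
      by (simp only: qpoch_Suc[of q] qnum_def power_Suc2[of "- q"] power_Suc[of q])
    have "q ^ (Suc m choose 2) * (c (Suc m) (Suc k) * qnum q (Suc k))
        = q ^ (m choose 2) * (q ^ m * ((1 - q powi (- int (Suc m))) * (- q))) * c m k / (1 - q)"
      unfolding c by (simp add: numeral_2_eq_2 power_add)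
    also have "\<dots> = qnum q (Suc m) * (q ^ (m choose 2) * c m k)"
      unfolding b by (simp add: qnum_def)
    finally show ?thesis .
  qed
  have "poly_qderiv q (hermiteI q (int n))
      = smult (q ^ (Suc m choose 2)) (\<Sum>k\<le>Suc m. smult (c (Suc m) k) (poly_qderiv q (\<phi> k)))"
    by (simp only: Suc H poly_qderiv_smult[OF Q(1)] poly_qderiv_sum[OF Q(1)])
  also have "\<dots> = smult (q ^ (Suc m choose 2))
      (\<Sum>k\<le>m. smult (c (Suc m) (Suc k)) (smult (qnum q (Suc k)) (\<phi> k)))"
    by (simp only: sum.atMost_Suc_shift \<phi>0 \<phi>) simp
  also have "\<dots> = (\<Sum>k\<le>m. smult (qnum q (Suc m) * (q ^ (m choose 2) * c m k)) (\<phi> k))"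
    by (simp only: smult_sum_right smult_smult coeff)
  also have "\<dots> = smult (qnum q n) (hermiteI q (int n - 1))"
    by (simp only: Suc H smult_sum_right smult_smult int_Suc diff_add_cancel add_diff_cancel_right')
  finally show ?thesis .
qed

lemma hgamma_0 [simp]: "hgamma q 0 = 0"
  by (simp add: hgamma_def)

lemma hgamma_Suc: "hgamma q (Suc m) = q ^ m * (1 - q ^ Suc m)"
  by (simp add: hgamma_def)

lemma hgamma_Suc_neq_0: "0 < q \<Longrightarrow> q < 1 \<Longrightarrow> hgamma q (Suc m) \<noteq> 0"
  using power_Suc_less_one[of q m] by (simp add: hgamma_Suc)

text \<open>The defect \<open>Z\<^sub>n\<close> of the recurrence satisfies \<open>D\<^sub>q Z\<^sub>n = q [n]\<^sub>q Z\<^sub>n\<^sub>-\<^sub>1\<close> by the Weyl relation and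
  lowering, and vanishes at \<open>1\<close>; so all of them vanish.\<close>

lemma hermiteI_recurrence:
  assumes "0 < q" "q < 1"
  shows "[:0, 1:] * hermiteI q (int n)
    = hermiteI q (int n + 1) + smult (hgamma q n) (hermiteI q (int n - 1))"
proof -
  have Q: "q \<noteq> 1" "q \<noteq> 0"
    using assms by auto
  note D = poly_qderiv_hermiteI[OF assms]
  define Z where "Z n = [:0, 1:] * hermiteI q (int n) - hermiteI q (int n + 1)
    - smult (hgamma q n) (hermiteI q (int n - 1))" for n
  have DZ: "poly_qderiv q (Z n)
      = hermiteI q (int n) + smult q ([:0, 1:] * smult (qnum q n) (hermiteI q (int n - 1)))
        - smult (qnum q (Suc n)) (hermiteI q (int n))
        - smult (hgamma q n) (poly_qderiv q (hermiteI q (int n - 1)))" for n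
    using D[of "Suc n"] 
    by (simp only: Z_def poly_qderiv_diff[OF Q(1)] poly_qderiv_var_mult[OF Q(1)]
        poly_qderiv_smult[OF Q(1)] D int_Suc add_diff_cancel_right' mult_smult_right) 
  have "Z n = 0"
  proof (induction n)
    case 0
    have "poly_qderiv q (Z 0) = 0"
      unfolding DZ by (simp add: qnum_Suc[OF Q(1)])
    moreover have "poly (Z 0) 1 = 0"
      using poly_hermiteI_1[of q 0] poly_hermiteI_1[of q 1] by (simp add: Z_def numeral_2_eq_2)
    ultimately show ?case
      by (rule poly_qderiv_eq_0_imp_eq_0[OF assms])
  next
    case (Suc m)
    have g: "hgamma q (Suc m) * qnum q m = q * qnum q (Suc m) * hgamma q m"
      using Q by (cases m) (simp_all add: hgamma_Suc qnum_def field_simps)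
    have "poly_qderiv q (Z (Suc m))
      = hermiteI q (int m + 1) + smult q ([:0, 1:] * smult (qnum q (Suc m)) (hermiteI q (int m)))
        - smult (1 + q * qnum q (Suc m)) (hermiteI q (int m + 1))
        - smult (hgamma q (Suc m)) (smult (qnum q m) (hermiteI q (int m - 1)))"
      unfolding DZ by (simp only: int_Suc add_diff_cancel_right' D qnum_Suc[OF Q(1), of "Suc m"])
    also have "\<dots> = smult (q * qnum q (Suc m)) (Z m)"
      unfolding Z_def smult_smult g
      by (simp add: smult_diff_right smult_add_left)
    finally have "poly_qderiv q (Z (Suc m)) = 0"
      using Suc by simp
    moreover have "poly (Z (Suc m)) 1 = 0"
    proof -
      have "poly (Z (Suc m)) 1
          = q ^ (Suc m choose 2) - q ^ (Suc (Suc m) choose 2) - hgamma q (Suc m) * q ^ (m choose 2)"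
        using poly_hermiteI_1[of q m] poly_hermiteI_1[of q "Suc m"] poly_hermiteI_1[of q "Suc (Suc m)"]
        by (simp add: Z_def add_ac)
      also have "\<dots> = 0"
        by (simp add: hgamma_Suc numeral_2_eq_2 power_add algebra_simps)
      finally show ?thesis .
    qed
    ultimately show ?case
      by (rule poly_qderiv_eq_0_imp_eq_0[OF assms])
  qed
  then show ?thesis
    by (simp add: Z_def algebra_simps)
qed

lemma hermiteI_monic:
  assumes "0 < q" "q < 1"
  shows "degree (hermiteI q (int n)) = n" "lead_coeff (hermiteI q (int n)) = 1"
proof -
  have rec: "hermiteI q (int (Suc n))
      = pCons 0 (hermiteI q (int n)) - smult (hgamma q n) (hermiteI q (int n - 1))" for n
    using hermiteI_recurrence[OF assms, of n] by (simp add: add.commute algebra_simps)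
  have *: "coeff (hermiteI q (int n)) n = 1 \<and> (\<forall>i>n. coeff (hermiteI q (int n)) i = 0)"
  proof (induction n rule: less_induct)
    case (less n)
    show ?case
    proof (cases n)
      case 0
      then show ?thesis
        by (simp add: hermiteI_0)
    next
      case (Suc m)
      have "coeff (hermiteI q (int m - 1)) i = 0" if "i \<ge> m" for i
      proof (cases m)
        case (Suc l)
        then show ?thesis
          using less[of l] that \<open>n = Suc m\<close> by auto
      qed (simp add: hermiteI_neg)
      then show ?thesis
        using less[of m] unfolding Suc rec by (auto simp: coeff_pCons split: nat.split)
    qed
  qed
  show "degree (hermiteI q (int n)) = n"
    by (rule antisym) (use * in \<open>auto intro: degree_le le_degree\<close>)
  then show "lead_coeff (hermiteI q (int n)) = 1"
    using * by simp
qed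

lemma qfalling_0 [simp]: "qfalling q n 0 = 1"
  by (simp add: qfalling_def qpoch_def numeral_2_eq_2)

lemma qfalling_Suc:
  assumes "0 < q" "q < 1" "k \<le> n"
  shows "qfalling q n (Suc k) = qfalling q n k * qnum q (n - k)"
proof -
  have e: "int (Suc k * n) - int (Suc k choose 2) = (int (k * n) - int (k choose 2)) + int (n - k)"
    using assms(3) by (simp add: numeral_2_eq_2 of_nat_diff)
  have "1 - q powi (- int n) * q ^ k = - (1 - q ^ (n - k)) / q ^ (n - k)"
  proof -
    have "q ^ n = q ^ (n - k) * q ^ k"
      using assms(3) by (simp flip: power_add)
    then show ?thesis
      using assms(1) unfolding power_int_minus power_int_of_nat by (simp add: field_simps)
  qed
  then have f: "(1 - q powi (- int n) * q ^ k) / (q - 1) * q ^ (n - k) = qnum q (n - k)"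
    using assms(1,2) by (simp add: qnum_def field_simps)
  have "qfalling q n (Suc k)
      = qfalling q n k * ((1 - q powi (- int n) * q ^ k) / (q - 1) * q ^ (n - k))"
  proof -
    have "q powi (int (Suc k * n) - int (Suc k choose 2))
        = q powi (int (k * n) - int (k choose 2)) * q ^ (n - k)"
      using assms(1) by (simp only: e) (simp add: power_int_add)
    then show ?thesis
      by (simp add: qfalling_def qpoch_Suc mult_ac)
  qed
  then show ?thesis
    by (simp only: f)
qed

lemma poly_qderiv_funpow_hermiteI:
  assumes "0 < q" "q < 1"
  shows "(poly_qderiv q ^^ k) (hermiteI q (int n))
    = smult (qfalling q n k) (hermiteI q (int n - int k))"
proof (induction k)
  case (Suc k)
  have Q: "q \<noteq> 1"
    using assms by simp
  show ?case
  proof (cases "k \<le> n")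
    case True
    then have "int n - int k = int (n - k)"
      by (simp add: of_nat_diff)
    then have "(poly_qderiv q ^^ Suc k) (hermiteI q (int n))
        = smult (qfalling q n k) (smult (qnum q (n - k)) (hermiteI q (int n - int k - 1)))"
      using Suc by (simp add: poly_qderiv_smult[OF Q] poly_qderiv_hermiteI[OF assms] del: of_nat_diff)
    moreover have "int n - int (Suc k) = int n - int k - 1"
      by simp
    ultimately show ?thesis
      by (simp only: smult_smult qfalling_Suc[OF assms True])
  next
    case False
    then show ?thesis
      using Suc by (simp add: hermiteI_neg poly_qderiv_0)
  qed
qed simp

section \<open>The q-integral against the q-Hermite weight\<close>

lemma qpoch_tendsto:
  assumes "0 < q" "q < 1"
  shows "convergent_prod (\<lambda>i. 1 - a * q ^ i)"
    and "(\<lambda>n. qpoch a q n) \<longlonglongrightarrow> qpoch_inf a q"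
proof -
  have "summable (\<lambda>i. norm ((1 - a * q ^ i) - 1))"
    using assms by (simp add: abs_mult power_abs summable_mult summable_geometric)
  then show conv: "convergent_prod (\<lambda>i. 1 - a * q ^ i)"
    by (intro abs_convergent_prod_imp_convergent_prod summable_imp_abs_convergent_prod)
  have "(\<lambda>n. qpoch a q (Suc n)) \<longlonglongrightarrow> qpoch_inf a q"
    using convergent_prod_LIMSEQ[OF conv]
    by (simp only: qpoch_def qpoch_inf_def lessThan_Suc_atMost)
  then show "(\<lambda>n. qpoch a q n) \<longlonglongrightarrow> qpoch_inf a q"
    by (rule LIMSEQ_imp_Suc)
qed

lemma qpoch_inf_shift:
  assumes "0 < q" "q < 1"
  shows "qpoch_inf a q = (1 - a) * qpoch_inf (a * q) q"
proof (rule LIMSEQ_unique)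
  show "(\<lambda>n. qpoch a q (Suc n)) \<longlonglongrightarrow> qpoch_inf a q"
    by (rule LIMSEQ_Suc[OF qpoch_tendsto(2)[OF assms]])
  show "(\<lambda>n. qpoch a q (Suc n)) \<longlonglongrightarrow> (1 - a) * qpoch_inf (a * q) q"
    unfolding qpoch_Suc_shift by (intro tendsto_mult_left qpoch_tendsto(2)[OF assms])
qed

lemma qpoch_inf_pos:
  assumes "0 < q" "q < 1" "a < 1"
  shows "qpoch_inf a q > 0"
proof -
  have "qpoch_inf a q \<ge> 0"
    by (rule LIMSEQ_le_const[OF qpoch_tendsto(2)[OF assms(1,2)]])
      (use qpoch_pos[OF assms] in \<open>auto intro!: less_imp_le\<close>)
  moreover have "1 - a * q ^ i \<noteq> 0" for i
    using qpoch_pos[OF assms, of "Suc i"] by (auto simp: qpoch_Suc)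
  then have "qpoch_inf a q \<noteq> 0"
    unfolding qpoch_inf_def by (intro prodinf_nonzero qpoch_tendsto(1)[OF assms(1,2)])
  ultimately show ?thesis
    by simp
qed

definition hermite_weight :: "real \<Rightarrow> real \<Rightarrow> real" where
  "hermite_weight q x = qpoch_inf (q * x) q * qpoch_inf (- q * x) q"

definition hermite_integral :: "real \<Rightarrow> real poly \<Rightarrow> real" where
  "hermite_integral q p = qint q (\<lambda>x. poly p x * hermite_weight q x)"

lemma hermite_weight_even: "hermite_weight q (- x) = hermite_weight q x"
  by (simp add: hermite_weight_def mult.commute)

text \<open>The Pearson equation of the weight.\<close>

lemma hermite_weight_shift:
  assumes "0 < q" "q < 1"
  shows "hermite_weight q x = (1 - q ^ 2 * x ^ 2) * hermite_weight q (q * x)"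
  unfolding hermite_weight_def
  by (subst qpoch_inf_shift[OF assms, of "q * x"], subst qpoch_inf_shift[OF assms, of "- q * x"])
    (simp add: algebra_simps power2_eq_square)

lemma hermite_weight_bounds:
  assumes "0 < q" "q < 1" "\<bar>x\<bar> \<le> 1"
  shows "0 \<le> hermite_weight q x" "hermite_weight q x \<le> 1"
proof -
  have f: "0 \<le> (1 - q * x * q ^ i) * (1 - (- q * x) * q ^ i)
    \<and> (1 - q * x * q ^ i) * (1 - (- q * x) * q ^ i) \<le> 1" for i
  proof -
    have "\<bar>x\<bar> * q ^ Suc i \<le> 1 * 1"
      using assms by (intro mult_mono power_le_one) auto
    then have "(x * q ^ Suc i) ^ 2 \<le> 1"
      using assms by (simp add: abs_square_le_1 abs_mult)
    moreover have "(1 - q * x * q ^ i) * (1 - (- q * x) * q ^ i) = 1 - (x * q ^ Suc i) ^ 2"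
      by (simp add: algebra_simps power2_eq_square)
    ultimately show ?thesis
      using zero_le_power2[of "x * q ^ Suc i"] by linarith
  qed
  have lim: "(\<lambda>n. \<Prod>i<n. (1 - q * x * q ^ i) * (1 - (- q * x) * q ^ i)) \<longlonglongrightarrow> hermite_weight q x"
    unfolding hermite_weight_def prod.distrib
    using tendsto_mult[OF qpoch_tendsto(2)[OF assms(1,2)] qpoch_tendsto(2)[OF assms(1,2)]]
    by (simp only: qpoch_def)
  show "0 \<le> hermite_weight q x"
    by (rule LIMSEQ_le_const[OF lim]) (use f in \<open>blast intro: prod_nonneg\<close>)
  show "hermite_weight q x \<le> 1"
    by (rule LIMSEQ_le_const2[OF lim]) (use f in \<open>blast intro: prod_le_1\<close>)
qed

lemma hermite_weight_power_bounds:
  assumes "0 < q" "q < 1"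
  shows "0 \<le> hermite_weight q (q ^ m)" "hermite_weight q (q ^ m) \<le> 1"
  using hermite_weight_bounds[OF assms, of "q ^ m"] assms by (auto simp: power_le_one)

lemma hermite_integral_sums:
  assumes "0 < q" "q < 1"
  shows "(\<lambda>m. (1 - q) * (q ^ m * ((poly p (q ^ m) + poly p (- (q ^ m))) * hermite_weight q (q ^ m))))
    sums hermite_integral q p"
proof -
  define h where "h m = q ^ m * ((poly p (q ^ m) + poly p (- (q ^ m))) * hermite_weight q (q ^ m))" for m
  obtain C where C: "C > 0" "\<And>z. norm z \<le> 1 \<Longrightarrow> norm (poly p z) \<le> C"
    using poly_bound_exists[of 1 p] by blast
  have "norm (h m) \<le> (2 * C) * q ^ m" for m
  proof -
    have "q ^ m \<le> 1"
      using assms by (simp add: power_le_one)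
    then have "\<bar>poly p (q ^ m) + poly p (- (q ^ m))\<bar> \<le> 2 * C"
      using C(2)[of "q ^ m"] C(2)[of "- (q ^ m)"] assms by (simp add: abs_if split: if_splits)
    then have "\<bar>poly p (q ^ m) + poly p (- (q ^ m))\<bar> * hermite_weight q (q ^ m) \<le> (2 * C) * 1"
      using hermite_weight_power_bounds[OF assms, of m] C(1) by (intro mult_mono) auto
    then have "q ^ m * (\<bar>poly p (q ^ m) + poly p (- (q ^ m))\<bar> * hermite_weight q (q ^ m)) \<le> q ^ m * (2 * C)"
      using assms by (intro mult_left_mono) auto
    then show ?thesis
      using hermite_weight_power_bounds[OF assms, of m] assms
      by (simp add: h_def abs_mult mult.commute)
  qed
  then have "summable h"
    using assms summable_comparison_test'[OF summable_mult[OF summable_geometric[of q]], of 0 h "2 * C"]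
    by simp
  then have "(\<lambda>m. (1 - q) * h m) sums ((1 - q) * suminf h)"
    by (intro sums_mult summable_sums)
  moreover have "hermite_integral q p = (1 - q) * suminf h"
    unfolding h_def[abs_def] by (simp add: hermite_integral_def qint_def hermite_weight_even distrib_right)
  ultimately show ?thesis
    by (simp add: h_def)
qed

lemma hermite_integral_add:
  assumes "0 < q" "q < 1"
  shows "hermite_integral q (p + r) = hermite_integral q p + hermite_integral q r"
  using sums_add[OF hermite_integral_sums[OF assms, of p] hermite_integral_sums[OF assms, of r]]
  by (intro sums_unique2[OF hermite_integral_sums[OF assms]]) (simp add: algebra_simps)

lemma hermite_integral_smult:
  assumes "0 < q" "q < 1"
  shows "hermite_integral q (smult c p) = c * hermite_integral q p"
  using sums_mult[OF hermite_integral_sums[OF assms, of p], of c]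
  by (intro sums_unique2[OF hermite_integral_sums[OF assms]]) (simp add: algebra_simps)

lemma hermite_integral_0: "0 < q \<Longrightarrow> q < 1 \<Longrightarrow> hermite_integral q 0 = 0"
  using hermite_integral_smult[of q 0 0] by simp

lemma hermite_integral_sum:
  assumes "0 < q" "q < 1"
  shows "hermite_integral q (sum f A) = (\<Sum>k\<in>A. hermite_integral q (f k))"
  by (induction A rule: infinite_finite_induct)
    (simp_all add: hermite_integral_add[OF assms] hermite_integral_0[OF assms])

text \<open>q-integration by parts.  By the Pearson equation, the function \<open>(1 - q) D\<^sub>q f - x f\<close> times the
  weight \<open>w\<close> is \<open>1 - q\<close> times the q-derivative of \<open>f(x) (1 - x\<^sup>2) w(x)\<close>.  The latter vanishes at
  \<open>\<plusminus>1\<close>, so the q-integral telescopes to \<open>0\<close>.\<close>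

lemma hermite_integral_var_mult:
  assumes "0 < q" "q < 1"
  shows "hermite_integral q ([:0, 1:] * f) = (1 - q) * hermite_integral q (poly_qderiv q f)"
proof -
  let ?w = "\<lambda>m. hermite_weight q (q ^ m)"
  define g where "g x = poly f x - poly f (- x)" for x
  define T where "T m = g (q ^ m) * ((1 - (q ^ m) ^ 2) * ?w m)" for m
  have "(\<lambda>m. q ^ m) \<longlonglongrightarrow> 0"
    by (rule LIMSEQ_realpow_zero) (use assms in auto)
  note lim = isCont_tendsto_compose[OF poly_isCont this]
    isCont_tendsto_compose[OF poly_isCont tendsto_minus[OF this]]
  have "(\<lambda>m. g (q ^ m)) \<longlonglongrightarrow> poly f 0 - poly f (- 0)"
    unfolding g_def by (rule tendsto_diff[OF lim])
  then have "(\<lambda>m. g (q ^ m)) \<longlonglongrightarrow> 0"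
    by simp
  then have "(\<lambda>m. \<bar>g (q ^ m)\<bar>) \<longlonglongrightarrow> 0"
    by (rule tendsto_rabs_zero)
  moreover have "norm (T m) \<le> \<bar>g (q ^ m)\<bar>" for m
  proof -
    have "0 \<le> (q ^ m) ^ 2" "(q ^ m) ^ 2 \<le> 1"
      using assms by (auto simp: power_le_one)
    then have "\<bar>1 - (q ^ m) ^ 2\<bar> * \<bar>?w m\<bar> \<le> 1 * 1"
      using hermite_weight_power_bounds[OF assms, of m] by (intro mult_mono) auto
    then have "\<bar>g (q ^ m)\<bar> * (\<bar>1 - (q ^ m) ^ 2\<bar> * \<bar>?w m\<bar>) \<le> \<bar>g (q ^ m)\<bar> * 1"
      by (intro mult_left_mono) auto
    then show ?thesis
      by (simp add: T_def abs_mult)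
  qed
  ultimately have "T \<longlonglongrightarrow> 0"
    by (intro Lim_null_comparison[of T]) simp_all
  then have tele: "(\<lambda>m. T m - T (Suc m)) sums (T 0 - 0)"
    by (rule telescope_sums')
  have integrand: "(1 - q) * (q ^ m * ((poly (poly_qderiv q f) (q ^ m) + poly (poly_qderiv q f) (- (q ^ m))) * ?w m))
      = q ^ m * ((poly ([:0, 1:] * f) (q ^ m) + poly ([:0, 1:] * f) (- (q ^ m))) * ?w m)
        + (T m - T (Suc m))" for m
  proof -
    let ?D = "poly (poly_qderiv q f) (q ^ m) + poly (poly_qderiv q f) (- (q ^ m))"
    have T: "T (Suc m) = g (q ^ Suc m) * ?w m"
      using hermite_weight_shift[OF assms, of "q ^ m"] by (simp add: T_def power_mult_distrib)
    have "(1 - q) * (q ^ m * ?D) = g (q ^ m) - g (q ^ Suc m)"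
      using assms by (simp add: poly_poly_qderiv g_def divide_simps) (simp add: algebra_simps)
    then have D: "(1 - q) * (q ^ m * (?D * ?w m)) = (g (q ^ m) - g (q ^ Suc m)) * ?w m"
      by (simp only: mult.assoc[symmetric])
    have f: "poly ([:0, 1:] * f) (q ^ m) + poly ([:0, 1:] * f) (- (q ^ m)) = q ^ m * g (q ^ m)"
      by (simp add: g_def algebra_simps)
    show ?thesis
      unfolding D f T unfolding T_def by (simp add: algebra_simps power2_eq_square)
  qed
  have "(\<lambda>m. (1 - q) * (q ^ m * ((poly ([:0, 1:] * f) (q ^ m) + poly ([:0, 1:] * f) (- (q ^ m))) * ?w m))
      + (1 - q) * (T m - T (Suc m))) sums (hermite_integral q ([:0, 1:] * f) + (1 - q) * (T 0 - 0))"
    by (intro sums_add sums_mult tele hermite_integral_sums assms)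
  moreover have "(\<lambda>m. (1 - q) * ((1 - q) * (q ^ m * ((poly (poly_qderiv q f) (q ^ m)
      + poly (poly_qderiv q f) (- (q ^ m))) * ?w m)))) sums ((1 - q) * hermite_integral q (poly_qderiv q f))"
    by (intro sums_mult hermite_integral_sums assms)
  ultimately have "hermite_integral q ([:0, 1:] * f) + (1 - q) * (T 0 - 0)
      = (1 - q) * hermite_integral q (poly_qderiv q f)"
    unfolding integrand distrib_left by (rule sums_unique2)
  then show ?thesis
    by (simp add: T_def)
qed

text \<open>The total mass.  Integration by parts gives the even moments the ratio \<open>1 - q ^ (2 N + 1)\<close>,
  hence \<open>M\<^sub>N (q; q)\<^sub>N (-q; q)\<^sub>N = M\<^sub>0 (q; q)\<^sub>2\<^sub>N\<close>.  As \<open>N\<close> grows, \<open>x ^ (2 N)\<close> sees only the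
  nodes \<open>\<plusminus>1\<close>, so \<open>M\<^sub>N\<close> tends to \<open>2 (1 - q)\<close> times the weight at \<open>1\<close>, and the limit of the
  identity determines \<open>M\<^sub>0\<close>.\<close>

lemma hermite_integral_1:
  assumes "0 < q" "q < 1"
  shows "hermite_integral q 1 = hnorm2 q 0"
proof -
  define M where "M N = hermite_integral q (monom 1 (2 * N))" for N
  have Msums: "(\<lambda>m. (1 - q) * (q ^ m * (2 * (q ^ m) ^ (2 * N) * hermite_weight q (q ^ m)))) sums M N" for N
    using hermite_integral_sums[OF assms, of "monom 1 (2 * N)"] by (simp add: M_def poly_monom)
  have rec: "M (Suc N) = (1 - q ^ (2 * N + 1)) * M N" for N
  proof -
    have "monom 1 (2 * Suc N) = [:0, 1:] * (monom 1 (Suc (2 * N)) :: real poly)"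
      by (simp add: monom_Suc)
    then have "M (Suc N) = (1 - q) * (qnum q (Suc (2 * N)) * M N)"
      using assms poly_qderiv_monom[of q 1 "2 * N"]
        hermite_integral_smult[OF assms, of "qnum q (Suc (2 * N))" "monom 1 (2 * N)"]
      by (simp only: M_def hermite_integral_var_mult[OF assms]) (simp add: smult_monom)
    then show ?thesis
      using assms qnum_mult[of q "Suc (2 * N)"] by (simp flip: mult.assoc)
  qed
  have closed: "M N * (qpoch q q N * qpoch (- q) q N) = M 0 * qpoch q q (2 * N)" for N
  proof (induction N)
    case (Suc N)
    have "qpoch q q (2 * Suc N) = qpoch q q (2 * N) * (1 - q ^ (2 * N + 1)) * (1 - q ^ (2 * N + 2))"
      by (simp add: qpoch_Suc)
    moreover have pair: "(1 - q * q ^ N) * (1 - (- q) * q ^ N) = 1 - q ^ (2 * N + 2)"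
    proof -
      have "2 * N + 2 = Suc N * 2"
        by simp
      then have "q ^ (2 * N + 2) = (q * q ^ N) ^ 2"
        by (simp only: power_mult power_Suc)
      moreover have "(1 - x) * (1 - - x) = 1 - x ^ 2" for x :: real
        by (simp add: algebra_simps power2_eq_square)
      ultimately show ?thesis
        by (metis mult_minus_left)
    qed
    have "M (Suc N) * (qpoch q q (Suc N) * qpoch (- q) q (Suc N))
        = (M N * (qpoch q q N * qpoch (- q) q N)) * (1 - q ^ (2 * N + 1))
          * ((1 - q * q ^ N) * (1 - (- q) * q ^ N))"
      unfolding rec qpoch_Suc by (simp only: mult_ac)
    then have "M (Suc N) * (qpoch q q (Suc N) * qpoch (- q) q (Suc N))
        = (M N * (qpoch q q N * qpoch (- q) q N)) * (1 - q ^ (2 * N + 1)) * (1 - q ^ (2 * N + 2))"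
      by (simp only: pair)
    ultimately show ?case
      unfolding Suc by simp
  qed (simp add: qpoch_def)
  let ?w = "hermite_weight q 1"
  have bound: "\<bar>M N - 2 * (1 - q) * ?w\<bar> \<le> 2 * q ^ (2 * N)" for N
  proof -
    let ?f = "\<lambda>m. (1 - q) * (q ^ m * (2 * (q ^ m) ^ (2 * N) * hermite_weight q (q ^ m)))"
    have tail: "(\<lambda>m. ?f (Suc m)) sums (M N - ?f 0)"
      using Msums[of N] iffD2[OF sums_Suc_iff[of ?f "M N - ?f 0"]] by (simp only: diff_add_cancel)
    have terms: "0 \<le> ?f (Suc m)" "?f (Suc m) \<le> (2 * q ^ (2 * N) * (1 - q)) * q ^ m" for m
    proof -
      show "0 \<le> ?f (Suc m)"
        using assms hermite_weight_power_bounds[OF assms, of "Suc m"] by simp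
      have le: "q ^ Suc m \<le> q" "q ^ Suc m \<le> q ^ m"
        using assms power_decreasing[of 1 "Suc m" q] power_decreasing[of m "Suc m" q] by simp_all
      then have "(q ^ Suc m) ^ (2 * N) \<le> q ^ (2 * N)"
        using assms by (intro power_mono) auto
      then have "q ^ Suc m * (2 * (q ^ Suc m) ^ (2 * N) * hermite_weight q (q ^ Suc m))
          \<le> q ^ m * (2 * q ^ (2 * N) * 1)"
        using le(2) assms hermite_weight_power_bounds[OF assms, of "Suc m"]
        by (intro mult_mono) (simp_all del: power_Suc)
      then have "?f (Suc m) \<le> (1 - q) * (q ^ m * (2 * q ^ (2 * N) * 1))"
        using assms by (intro mult_left_mono) auto
      then show "?f (Suc m) \<le> (2 * q ^ (2 * N) * (1 - q)) * q ^ m"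
        by (simp only: mult_ac mult_1_right)
    qed
    have geom: "(\<lambda>m. (2 * q ^ (2 * N) * (1 - q)) * q ^ m) sums ((2 * q ^ (2 * N) * (1 - q)) * (1 / (1 - q)))"
      using assms by (intro sums_mult geometric_sums) auto
    have "0 \<le> M N - ?f 0" "M N - ?f 0 \<le> (2 * q ^ (2 * N) * (1 - q)) * (1 / (1 - q))"
      using sums_le[OF terms(1) sums_zero tail] sums_le[OF terms(2) tail geom] by blast+
    moreover have "(2 * q ^ (2 * N) * (1 - q)) * (1 / (1 - q)) = 2 * q ^ (2 * N)"
      using assms by simp
    moreover have "?f 0 = 2 * (1 - q) * ?w"
      by (simp add: algebra_simps)
    ultimately show ?thesis
      by linarith
  qed
  have "(\<lambda>N. 2 * q ^ (2 * N)) \<longlonglongrightarrow> 2 * 0"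
    unfolding power_mult using assms by (intro tendsto_mult_left LIMSEQ_realpow_zero) (auto simp: power_less_one_iff)
  then have small: "(\<lambda>N. 2 * q ^ (2 * N)) \<longlonglongrightarrow> 0"
    by (simp only: mult_zero_right)
  have "(\<lambda>N. M N - 2 * (1 - q) * ?w) \<longlonglongrightarrow> 0"
    by (rule Lim_null_comparison[OF _ small]) (use bound in \<open>simp only: real_norm_def eventually_True\<close>)
  then have "M \<longlonglongrightarrow> 2 * (1 - q) * ?w"
    by (rule LIM_zero_cancel)
  then have "(\<lambda>N. M N * (qpoch q q N * qpoch (- q) q N))
      \<longlonglongrightarrow> 2 * (1 - q) * ?w * (qpoch_inf q q * qpoch_inf (- q) q)"
    by (intro tendsto_mult qpoch_tendsto(2)[OF assms])
  moreover have "(\<lambda>N. M 0 * qpoch q q (2 * N)) \<longlonglongrightarrow> M 0 * qpoch_inf q q"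
    by (intro tendsto_mult_left filterlim_compose[OF qpoch_tendsto(2)[OF assms]] mult_nat_left_at_top) simp
  ultimately have "2 * (1 - q) * ?w * (qpoch_inf q q * qpoch_inf (- q) q) = M 0 * qpoch_inf q q"
    unfolding closed by (rule LIMSEQ_unique)
  then have "M 0 = 2 * (1 - q) * ?w * qpoch_inf (- q) q"
    using qpoch_inf_pos[OF assms, of q] assms by simp
  then show ?thesis
    using qpoch_inf_shift[OF assms, of "- 1"]
    by (simp add: M_def hnorm2_def hermite_weight_def qpoch_def numeral_2_eq_2 monom_0 flip: one_pCons)
qed

lemma hnorm2_Suc: "hnorm2 q (Suc n) = hgamma q (Suc n) * hnorm2 q n"
  by (simp add: hnorm2_def hgamma_Suc qpoch_Suc numeral_2_eq_2 power_add)

lemma hnorm2_pos: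
  assumes "0 < q" "q < 1"
  shows "hnorm2 q n > 0"
  using assms unfolding hnorm2_def by (intro mult_pos_pos qpoch_pos qpoch_inf_pos) auto

text \<open>Combining the recurrence with integration by parts, the integral of \<open>H\<^sub>n\<^sub>+\<^sub>1\<close> is
  \<open>(1 - q ^ n) (1 - q ^ (n - 1))\<close> times that of \<open>H\<^sub>n\<^sub>-\<^sub>1\<close>; this kills \<open>H\<^sub>1\<close> and \<open>H\<^sub>2\<close>.\<close>

lemma hermite_integral_hermiteI:
  assumes "0 < q" "q < 1"
  shows "hermite_integral q (hermiteI q (int (Suc n))) = 0"
proof (induction n rule: less_induct)
  case (less n)
  have "hermite_integral q (hermiteI q (int (Suc n)))
      = hermite_integral q ([:0, 1:] * hermiteI q (int n))
        - hgamma q n * hermite_integral q (hermiteI q (int n - 1))"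
    unfolding hermiteI_recurrence[OF assms]
    by (simp add: hermite_integral_add[OF assms] hermite_integral_smult[OF assms] add.commute)
  also have "\<dots> = ((1 - q ^ n) - hgamma q n) * hermite_integral q (hermiteI q (int n - 1))"
    using qnum_mult[of q n] assms
    by (simp only: hermite_integral_var_mult[OF assms] poly_qderiv_hermiteI[OF assms]
        hermite_integral_smult[OF assms]) (simp add: left_diff_distrib flip: mult.assoc)
  also have "\<dots> = 0"
  proof (cases n)
    case (Suc m)
    then show ?thesis
      using less[of "m - 1"] by (cases m) (simp_all add: hgamma_Suc)
  qed simp
  finally show ?case .
qed

text \<open>Favard: with the recurrence applied to either factor, orthogonality and the norms
  \<open>\<parallel>H\<^sub>n\<^sub>+\<^sub>1\<parallel>\<^sup>2 = \<gamma>\<^sub>n\<^sub>+\<^sub>1 \<parallel>H\<^sub>n\<parallel>\<^sup>2\<close> propagate from the integrals of the single polynomials.\<close>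

lemma hermite_integral_orthogonal:
  assumes "0 < q" "q < 1"
  shows "hermite_integral q (hermiteI q (int m) * hermiteI q (int n))
    = (if m = n then hnorm2 q n else 0)"
proof (induction m arbitrary: n rule: less_induct)
  case (less m)
  note L = hermite_integral_add[OF assms] hermite_integral_smult[OF assms]
  show ?case
  proof (cases m)
    case 0
    then show ?thesis
      using hermite_integral_1[OF assms] hermite_integral_hermiteI[OF assms, of "n - 1"]
      by (cases n) (simp_all add: hermiteI_0)
  next
    case (Suc k)
    have "[:0, 1:] * (hermiteI q (int k) * hermiteI q (int n))
        = hermiteI q (int m) * hermiteI q (int n)
          + smult (hgamma q k) (hermiteI q (int k - 1) * hermiteI q (int n))"
      using hermiteI_recurrence[OF assms, of k]
      by (simp only: Suc int_Suc mult.assoc[symmetric]) (simp add: distrib_right)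
    moreover have "[:0, 1:] * (hermiteI q (int k) * hermiteI q (int n))
        = hermiteI q (int k) * hermiteI q (int (Suc n))
          + smult (hgamma q n) (hermiteI q (int k) * hermiteI q (int n - 1))"
      using hermiteI_recurrence[OF assms, of n]
      by (simp only: int_Suc mult.left_commute[of "[:0, 1:]"]) (simp add: distrib_left)
    ultimately have "hermite_integral q (hermiteI q (int m) * hermiteI q (int n)
          + smult (hgamma q k) (hermiteI q (int k - 1) * hermiteI q (int n)))
        = hermite_integral q (hermiteI q (int k) * hermiteI q (int (Suc n))
          + smult (hgamma q n) (hermiteI q (int k) * hermiteI q (int n - 1)))"
      by (simp only:)
    then have "hermite_integral q (hermiteI q (int m) * hermiteI q (int n))
        + hgamma q k * hermite_integral q (hermiteI q (int k - 1) * hermiteI q (int n))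
      = hermite_integral q (hermiteI q (int k) * hermiteI q (int (Suc n)))
        + hgamma q n * hermite_integral q (hermiteI q (int k) * hermiteI q (int n - 1))"
      by (simp only: L)
    moreover have "hermite_integral q (hermiteI q (int k) * hermiteI q (int (Suc n)))
        = (if k = Suc n then hnorm2 q (Suc n) else 0)"
      using less[of k "Suc n"] Suc by (simp del: of_nat_Suc)
    moreover have "hgamma q n * hermite_integral q (hermiteI q (int k) * hermiteI q (int n - 1))
        = (if n = Suc k then hnorm2 q n else 0)"
      using less[of k] Suc by (cases n) (auto simp: hnorm2_Suc)
    moreover have "hgamma q k * hermite_integral q (hermiteI q (int k - 1) * hermiteI q (int n))
        = (if k = Suc n then hnorm2 q (Suc n) else 0)"
      using less[of "k - 1"] Suc by (cases k) (auto simp: hnorm2_Suc)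
    ultimately show ?thesis
      using Suc by auto
  qed
qed

section \<open>The Sobolev polynomials and the kernel\<close>

lemma sobolev_inner_eq:
  assumes "q \<noteq> 1"
  shows "sobolev_inner q \<alpha> lam j f g = hermite_integral q (f * g)
    + lam * poly ((poly_qderiv q ^^ j) f) \<alpha> * poly ((poly_qderiv q ^^ j) g) \<alpha>"
  by (simp add: sobolev_inner_def hermite_integral_def hermite_weight_def qderiv_funpow_poly[OF assms])

lemma sobolev_inner_sum_right:
  assumes "0 < q" "q < 1"
  shows "sobolev_inner q \<alpha> lam j f (\<Sum>i\<in>A. smult (a i) (g i))
    = (\<Sum>i\<in>A. a i * sobolev_inner q \<alpha> lam j f (g i))"
proof -
  have Q: "q \<noteq> 1"
    using assms by simp
  show ?thesis
    by (simp add: sobolev_inner_eq[OF Q] sum_distrib_left hermite_integral_sum[OF assms]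
        hermite_integral_smult[OF assms] poly_qderiv_funpow_sum[OF Q]
        poly_qderiv_funpow_linear[OF Q] poly_sum sum.distrib algebra_simps)
qed

lemma monic_basis_expansion:
  fixes p :: "'a :: comm_ring_1 poly"
  assumes "\<And>k. degree (B k) = k" "\<And>k. lead_coeff (B k) = 1"
    and "\<And>i. i \<ge> n \<Longrightarrow> coeff p i = 0"
  obtains a where "p = (\<Sum>k<n. smult (a k) (B k))"
  using assms(3)
proof (induction n arbitrary: p thesis)
  case 0
  then have "p = 0"
    by (intro poly_eqI) simp
  then show ?case
    using 0(1) by simp
next
  case (Suc n)
  have "coeff (p - smult (coeff p n) (B n)) i = 0" if "i \<ge> n" for i
    using that Suc.prems(2)[of i] assms(1)[of n] assms(2)[of n]
    by (cases "i = n") (auto simp: coeff_eq_0)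
  then obtain a where "p - smult (coeff p n) (B n) = (\<Sum>k<n. smult (a k) (B k))"
    using Suc.IH by blast
  then have "p = (\<Sum>k<Suc n. smult ((a(n := coeff p n)) k) (B k))"
    by (simp add: algebra_simps)
  then show ?case
    by (rule Suc.prems(1))
qed

lemma hderiv_eq: "q \<noteq> 1 \<Longrightarrow> hderiv q k m y = poly ((poly_qderiv q ^^ k) (hermiteI q m)) y"
  by (simp add: hderiv_def qderiv_funpow_poly)

text \<open>This is the partial kernel of orders \<open>0\<close> and \<open>j\<close>, up to degree \<open>n - 1\<close>, kept as a polynomial
  in its first argument so that the q-derivative can act on it.\<close>

definition kernel_poly :: "real \<Rightarrow> nat \<Rightarrow> nat \<Rightarrow> real \<Rightarrow> real poly" where
  "kernel_poly q j n y = (\<Sum>k<n. smult (hderiv q j (int k) y / hnorm2 q k) (hermiteI q (int k)))"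

text \<open>Testing \<open>S\<^sub>n\<close> against \<open>H\<^sub>k\<close> with \<open>k < n\<close> shows that the Fourier coefficients of \<open>S\<^sub>n\<close> are
  proportional to the coefficients of the kernel, with factor \<open>-\<lambda> (D\<^sub>q\<^sup>j S\<^sub>n)(\<alpha>)\<close>.  Applying
  \<open>D\<^sub>q\<^sup>j\<close> at \<open>\<alpha>\<close> to the resulting expansion gives a linear equation for the unknown
  \<open>(D\<^sub>q\<^sup>j S\<^sub>n)(\<alpha>)\<close>.\<close>

lemma sobolev_poly_eq_kernel:
  assumes q: "0 < q" "q < 1" and lam: "lam > 0" and S: "sobolev_polys q \<alpha> lam j S" and n: "n \<ge> 1"
  shows "S n = hermiteI q (int n) - smult (sobc q \<alpha> lam j n) (kernel_poly q j n \<alpha>)"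
proof -
  have Q: "q \<noteq> 1"
    using q by simp
  define s where "s = poly ((poly_qderiv q ^^ j) (S n)) \<alpha>"
  let ?d = "\<lambda>k. hderiv q j (int k) \<alpha>"
  have degS: "degree (S k) = k" "lead_coeff (S k) = 1" for k
    using S unfolding sobolev_polys_def by blast+
  note degH = hermiteI_monic[OF q]
  \<comment> \<open>\<open>H\<^sub>k\<close> is a combination of \<open>S\<^sub>0, \<dots>, S\<^sub>k\<close>, to all of which \<open>S\<^sub>n\<close> is orthogonal.\<close>
  have orth: "sobolev_inner q \<alpha> lam j (S n) (hermiteI q (int k)) = 0" if "k < n" for k
  proof -
    have "coeff (hermiteI q (int k)) i = 0" if "i \<ge> Suc k" for i
      using that degH(1)[of k] by (intro coeff_eq_0) simp
    then obtain a where a: "hermiteI q (int k) = (\<Sum>i<Suc k. smult (a i) (S i))"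
      using monic_basis_expansion[of S "Suc k" "hermiteI q (int k)"] degS by blast
    have "sobolev_inner q \<alpha> lam j (S n) (S i) = 0" if "i < Suc k" for i
      using S that \<open>k < n\<close> by (auto simp: sobolev_polys_def)
    then show ?thesis
      unfolding a sobolev_inner_sum_right[OF q] by simp
  qed
  have "coeff (S n - hermiteI q (int n)) i = 0" if "i \<ge> n" for i
    using that degS[of n] degH[of n] by (cases "i = n") (auto simp: coeff_eq_0)
  then obtain a where "S n - hermiteI q (int n) = (\<Sum>k<n. smult (a k) (hermiteI q (int k)))"
    using monic_basis_expansion[of "\<lambda>k. hermiteI q (int k)" n "S n - hermiteI q (int n)"] degH by blast
  then have a: "S n = hermiteI q (int n) + (\<Sum>k<n. smult (a k) (hermiteI q (int k)))"
    by (simp add: algebra_simps)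
  have "a k = - (lam * s) * (?d k / hnorm2 q k)" if "k < n" for k
  proof -
    have "hermite_integral q (S n * hermiteI q (int k)) = (\<Sum>i<n. a i * (if i = k then hnorm2 q k else 0))"
      using that unfolding a
      by (simp add: distrib_right sum_distrib_right hermite_integral_add[OF q] hermite_integral_sum[OF q]
          hermite_integral_smult[OF q] hermite_integral_orthogonal[OF q])
    also have "\<dots> = a k * hnorm2 q k"
      using that by (simp add: if_distrib sum.delta' cong: if_cong)
    finally have "a k * hnorm2 q k + lam * s * ?d k = 0"
      using orth[OF that] by (simp add: sobolev_inner_eq[OF Q] hderiv_eq[OF Q] s_def)
    then show ?thesis
      using hnorm2_pos[OF q, of k] by (simp add: field_simps add_eq_0_iff2)
  qed
  then have "(\<Sum>k<n. smult (a k) (hermiteI q (int k))) = - smult (lam * s) (kernel_poly q j n \<alpha>)"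
    unfolding kernel_poly_def by (simp add: smult_sum_right flip: sum_negf)
  then have Sn: "S n = hermiteI q (int n) - smult (lam * s) (kernel_poly q j n \<alpha>)"
    using a by simp
  have K: "poly ((poly_qderiv q ^^ j) (kernel_poly q j n \<alpha>)) \<alpha> = hkernel q j j (n - 1) \<alpha> \<alpha>"
  proof -
    have "{..n - 1} = {..<n}"
      using n by auto
    then show ?thesis
      by (simp add: kernel_poly_def hkernel_def poly_qderiv_funpow_sum[OF Q]
          poly_qderiv_funpow_linear[OF Q] poly_sum hderiv_eq[OF Q])
  qed
  \<comment> \<open>The linear equation for \<open>s\<close> is solvable, as its coefficient is at least \<open>1\<close>.\<close>
  have "hkernel q j j (n - 1) \<alpha> \<alpha> \<ge> 0"
    unfolding hkernel_def by (intro sum_nonneg divide_nonneg_pos hnorm2_pos[OF q]) simp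
  then have pos: "1 + lam * hkernel q j j (n - 1) \<alpha> \<alpha> > 0"
    using lam by (simp add: add_pos_nonneg)
  have "s = ?d n - lam * s * hkernel q j j (n - 1) \<alpha> \<alpha>"
    using arg_cong[OF Sn, of "\<lambda>p. poly ((poly_qderiv q ^^ j) p) \<alpha>"]
    by (simp add: poly_qderiv_funpow_linear[OF Q] K hderiv_eq[OF Q] flip: s_def)
  then have "s * (1 + lam * hkernel q j j (n - 1) \<alpha> \<alpha>) = ?d n"
    by (simp add: algebra_simps)
  also have "?d n = qfalling q n j * poly (hermiteI q (int n - int j)) \<alpha>"
    by (simp add: hderiv_eq[OF Q] poly_qderiv_funpow_hermiteI[OF q])
  finally have "lam * s = sobc q \<alpha> lam j n"
    using pos by (simp add: sobc_def field_simps)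
  then show ?thesis
    using Sn by simp
qed

section \<open>The kernel as a combination of two consecutive polynomials\<close>

text \<open>The Christoffel-Darboux formula, read as an identity of polynomials in the second variable,
  to which \<open>D\<^sub>q\<^sup>j\<close> can then be applied.\<close>

lemma christoffel_darboux:
  assumes "0 < q" "q < 1"
  shows "[:x, - 1:] * (\<Sum>k<Suc m. smult (poly (hermiteI q (int k)) x / hnorm2 q k) (hermiteI q (int k)))
    = smult (1 / hnorm2 q m)
        (smult (poly (hermiteI q (int (Suc m))) x) (hermiteI q (int m))
          - smult (poly (hermiteI q (int m)) x) (hermiteI q (int (Suc m))))"
proof (induction m)
  case 0
  have "hermiteI q 1 = [:0, 1:]"
    using hermiteI_recurrence[OF assms, of 0] by (simp add: hermiteI_0)
  then show ?case
    by (simp add: hermiteI_0 smult_diff_right)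
next
  case (Suc m)
  have rec: "y * poly (hermiteI q (int (Suc m))) y
      = poly (hermiteI q (int (Suc (Suc m)))) y + hgamma q (Suc m) * poly (hermiteI q (int m)) y" for y
    using arg_cong[OF hermiteI_recurrence[OF assms, of "Suc m"], of "\<lambda>p. poly p y"]
    by (simp add: add.commute)
  have nz: "hgamma q (Suc m) \<noteq> 0" "hnorm2 q m \<noteq> 0"
    using hgamma_Suc_neq_0[OF assms] hnorm2_pos[OF assms, of m] by auto
  show ?case
  proof (rule poly_ext)
    fix y
    have alg: "(x - y) * (A' * B' / (g * h)) + (A' * B - A * B') / h = (A'' * B' - A' * B'') / (g * h)"
      if "x * A' = A'' + g * A" "y * B' = B'' + g * B" "g \<noteq> 0" "h \<noteq> 0" for A A' A'' B B' B'' g h :: real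
    proof -
      have "(x - y) * (A' * B') + g * (A' * B - A * B') = A'' * B' - A' * B''"
        using that(1,2) by algebra
      moreover have "(x - y) * (A' * B' / (g * h)) + (A' * B - A * B') / h
          = ((x - y) * (A' * B') + g * (A' * B - A * B')) / (g * h)"
        using that(3,4) by (simp add: add_divide_distrib)
      ultimately show ?thesis
        by (simp only:)
    qed
    have lin: "poly ([:x, - 1:] * p) y = (x - y) * poly p y" for p
      by (simp add: algebra_simps)
    have IH: "(x - y) * poly (\<Sum>k<Suc m. smult (poly (hermiteI q (int k)) x / hnorm2 q k) (hermiteI q (int k))) y
      = (poly (hermiteI q (int (Suc m))) x * poly (hermiteI q (int m)) y
          - poly (hermiteI q (int m)) x * poly (hermiteI q (int (Suc m))) y) / hnorm2 q m"
      unfolding lin[symmetric] Suc by (simp del: of_nat_Suc)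
    show "poly ([:x, - 1:] * (\<Sum>k<Suc (Suc m). smult (poly (hermiteI q (int k)) x / hnorm2 q k) (hermiteI q (int k)))) y
      = poly (smult (1 / hnorm2 q (Suc m))
        (smult (poly (hermiteI q (int (Suc (Suc m)))) x) (hermiteI q (int (Suc m)))
          - smult (poly (hermiteI q (int (Suc m))) x) (hermiteI q (int (Suc (Suc m)))))) y"
      using alg[OF rec[of x] rec[of y] nz]
      unfolding sum.lessThan_Suc[of _ "Suc m"] hnorm2_Suc[of q m] lin poly_add distrib_left IH
      by (simp add: add.commute mult.commute[of "hnorm2 q m"] del: of_nat_Suc sum.lessThan_Suc)
  qed
qed

lemma poly_qderiv_funpow_linear_factor:
  assumes "q \<noteq> 1"
  shows "(poly_qderiv q ^^ m) ([:x, - 1:] * k)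
    = [:x, - (q ^ m):] * (poly_qderiv q ^^ m) k - smult (qnum q m) ((poly_qderiv q ^^ (m - 1)) k)"
proof (induction m)
  case (Suc m)
  have D: "poly_qderiv q ([:x, - b:] * u) = [:x, - (q * b):] * poly_qderiv q u - smult b u" for b u
  proof -
    have "poly_qderiv q [:x, - b:] = [:- b:]"
      by (rule poly_qderiv_eqI) (use assms in \<open>simp_all add: pcompose_pCons algebra_simps\<close>)
    then show ?thesis
      unfolding poly_qderiv_mult[OF assms] by (simp add: pcompose_pCons mult.commute[of b])
  qed
  have "(poly_qderiv q ^^ Suc m) ([:x, - 1:] * k)
      = [:x, - (q * q ^ m):] * (poly_qderiv q ^^ Suc m) k - smult (q ^ m) ((poly_qderiv q ^^ m) k)
        - smult (qnum q m) (poly_qderiv q ((poly_qderiv q ^^ (m - 1)) k))"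
    by (simp only: funpow.simps o_apply Suc poly_qderiv_diff[OF assms] poly_qderiv_smult[OF assms] D)
  also have "smult (qnum q m) (poly_qderiv q ((poly_qderiv q ^^ (m - 1)) k)) = smult (qnum q m) ((poly_qderiv q ^^ m) k)"
    by (cases m) simp_all
  also have "[:x, - (q * q ^ m):] * (poly_qderiv q ^^ Suc m) k - smult (q ^ m) ((poly_qderiv q ^^ m) k)
        - smult (qnum q m) ((poly_qderiv q ^^ m) k)
      = [:x, - (q ^ Suc m):] * (poly_qderiv q ^^ Suc m) k - smult (qnum q (Suc m)) ((poly_qderiv q ^^ m) k)"
  proof -
    have "qnum q (Suc m) = q ^ m + qnum q m"
      using assms by (simp add: qnum_def field_simps)
    then show ?thesis
      by (simp only: smult_add_left diff_diff_eq power_Suc)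
  qed
  finally show ?case
    by (simp only: diff_Suc_1)
qed simp

text \<open>Iterating \<open>D\<^sup>m((x - y) k) = (x - q\<^sup>m y) D\<^sup>m k - [m] D\<^sup>m\<^sup>-\<^sup>1 k\<close> solves for \<open>D\<^sup>m k\<close>, where the
  linear factors accumulate to the q-subtraction power.  This is a q-Leibniz formula for the
  quotient of \<open>(x - y) k(y)\<close> by \<open>x - y\<close>.\<close>

lemma q_leibniz_quotient:
  assumes "0 < q" "q < 1"
  shows "poly (qsubpow q y (Suc m)) x * poly ((poly_qderiv q ^^ m) k) y
    = qfact q m * (\<Sum>i\<le>m. poly ((poly_qderiv q ^^ i) ([:x, - 1:] * k)) y / qfact q i * poly (qsubpow q y i) x)"
proof (induction m)
  case 0
  show ?case
    by (simp add: qsubpow_Suc[OF assms] qsubpow_0 algebra_simps)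
next
  case (Suc m)
  have Q: "q \<noteq> 1"
    using assms by simp
  let ?S = "\<lambda>n. \<Sum>i\<le>n. poly ((poly_qderiv q ^^ i) ([:x, - 1:] * k)) y / qfact q i * poly (qsubpow q y i) x"
  let ?P = "poly (qsubpow q y (Suc m)) x"
  let ?g = "poly ((poly_qderiv q ^^ Suc m) ([:x, - 1:] * k)) y"
  have "?g = (x - q ^ Suc m * y) * poly ((poly_qderiv q ^^ Suc m) k) y
      - qnum q (Suc m) * poly ((poly_qderiv q ^^ m) k) y"
    unfolding poly_qderiv_funpow_linear_factor[OF Q, of "Suc m"] by (simp add: algebra_simps)
  then have "?g + qnum q (Suc m) * poly ((poly_qderiv q ^^ m) k) y
      = (x - q ^ Suc m * y) * poly ((poly_qderiv q ^^ Suc m) k) y"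
    by simp
  moreover have "poly (qsubpow q y (Suc (Suc m))) x = ?P * (x - q ^ Suc m * y)"
    unfolding qsubpow_Suc[OF assms, of y "Suc m"] by (simp add: algebra_simps)
  ultimately have "poly (qsubpow q y (Suc (Suc m))) x * poly ((poly_qderiv q ^^ Suc m) k) y
      = ?P * (?g + qnum q (Suc m) * poly ((poly_qderiv q ^^ m) k) y)"
    by (simp only: mult.assoc)
  also have "\<dots> = ?P * ?g + qnum q (Suc m) * (qfact q m * ?S m)"
    using Suc by (simp add: distrib_left mult.left_commute)
  also have "\<dots> = qfact q (Suc m) * (?S m + ?g / qfact q (Suc m) * ?P)"
    using qfact_pos[OF assms, of m] qnum_pos[OF assms, of "Suc m"]
    by (simp add: qfact_Suc[of q m] distrib_left del: funpow.simps mult_pCons_left)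
  also have "?S m + ?g / qfact q (Suc m) * ?P = ?S (Suc m)"
    by (rule sum.atMost_Suc[symmetric])
  finally show ?case .
qed

lemma rconst_mult: "rconst c * to_fract p = to_fract (smult c p)"
  by (simp flip: to_fract_mult)

text \<open>For each fixed \<open>x\<close>, the q-Leibniz formula is applied to the kernel as a polynomial in its
  second variable; by Christoffel-Darboux the q-derivatives on its right-hand side are those of
  \<open>H\<^sub>n\<^sub>-\<^sub>1\<close> and \<open>H\<^sub>n\<close>.  Clearing the denominator turns the claim into a polynomial identity.\<close>

lemma kernel_poly_eq_calA_calB:
  assumes "0 < q" "q < 1" "n \<ge> 1"
  shows "to_fract (kernel_poly q j n y)
    = calA q j n y * to_fract (hermiteI q (int n)) + calB q j n y * to_fract (hermiteI q (int n - 1))"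
proof -
  obtain m where m: "n = Suc m"
    using assms(3) by (cases n) auto
  have idx: "int n - 1 = int m"
    using m by simp
  have Q: "q \<noteq> 1"
    using assms by simp
  define U where "U r = (\<Sum>i\<le>j. smult (hderiv q i (int r) y / qfact q i) (qsubpow q y i))" for r
  let ?P = "qsubpow q y (j + 1)"
  have h: "hnorm2 q m \<noteq> 0"
    using hnorm2_pos[OF assms(1,2), of m] by simp
  have main: "smult (hnorm2 q m) (?P * kernel_poly q j n y)
      = smult (qfact q j) (hermiteI q (int n) * U m - hermiteI q (int m) * U n)"
  proof (rule poly_ext)
    fix x
    define k where "k = (\<Sum>i<Suc m. smult (poly (hermiteI q (int i)) x / hnorm2 q i) (hermiteI q (int i)))"
    have "poly (kernel_poly q j n y) x = poly ((poly_qderiv q ^^ j) k) y"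
      by (simp add: kernel_poly_def k_def m poly_sum poly_qderiv_funpow_sum[OF Q]
          poly_qderiv_funpow_linear[OF Q] hderiv_eq[OF Q] mult.commute del: sum.lessThan_Suc)
    then have "poly ?P x * poly (kernel_poly q j n y) x
        = qfact q j * (\<Sum>i\<le>j. poly ((poly_qderiv q ^^ i) ([:x, - 1:] * k)) y / qfact q i * poly (qsubpow q y i) x)"
      using q_leibniz_quotient[OF assms(1,2), of y j x k] by simp
    also have "(\<Sum>i\<le>j. poly ((poly_qderiv q ^^ i) ([:x, - 1:] * k)) y / qfact q i * poly (qsubpow q y i) x)
        = (poly (hermiteI q (int n)) x * poly (U m) x - poly (hermiteI q (int m)) x * poly (U n) x) / hnorm2 q m"
      unfolding k_def christoffel_darboux[OF assms(1,2)] m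
      by (simp add: U_def poly_sum poly_qderiv_funpow_linear[OF Q] hderiv_eq[OF Q]
          sum_distrib_left sum_divide_distrib sum_subtractf[symmetric] del: of_nat_Suc)
        (intro sum.cong refl, use h in \<open>simp add: divide_simps, simp add: algebra_simps\<close>)
    finally show "poly (smult (hnorm2 q m) (?P * kernel_poly q j n y)) x
        = poly (smult (qfact q j) (hermiteI q (int n) * U m - hermiteI q (int m) * U n)) x"
      using h by simp
  qed
  let ?c = "rconst (qfact q j) / (rconst (hnorm2 q m) * to_fract ?P)"
  have A: "calA q j n y = ?c * to_fract (U m)" and B: "calB q j n y = - ?c * to_fract (U n)"
    by (simp_all add: calA_def calB_def U_def m rconst_mult)
  have nz: "rconst (hnorm2 q m) * to_fract ?P \<noteq> 0"
    using h qsubpow_nonzero[OF assms(1,2)] by simp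
  have "rconst (hnorm2 q m) * to_fract ?P * to_fract (kernel_poly q j n y)
      = rconst (qfact q j) * (to_fract (hermiteI q (int n)) * to_fract (U m) - to_fract (hermiteI q (int m)) * to_fract (U n))"
    using arg_cong[OF main, of to_fract] by (simp only: rconst_mult[symmetric] to_fract_mult to_fract_diff mult.assoc)
  then have "to_fract (kernel_poly q j n y)
      = rconst (qfact q j) * (to_fract (hermiteI q (int n)) * to_fract (U m) - to_fract (hermiteI q (int m)) * to_fract (U n))
        / (rconst (hnorm2 q m) * to_fract ?P)"
    using nz by (metis nonzero_mult_div_cancel_left)
  also have "\<dots> = ?c * to_fract (U m) * to_fract (hermiteI q (int n)) + - ?c * to_fract (U n) * to_fract (hermiteI q (int m))"
  proof -
    have "c * (h * u - g * v) / d = c / d * u * h + - (c / d) * v * g"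
      for c d g h u v :: "real poly fract"
      by (simp add: diff_divide_distrib algebra_simps)
    then show ?thesis .
  qed
  finally show ?thesis
    by (simp only: A B idx)
qed

section \<open>Ladder formulas and the recurrence\<close>

text \<open>Cramer's rule: three vectors in a plane satisfy a linear relation whose coefficients are
  their pairwise determinants.  Stated without division, it holds also where the determinant in
  front of \<open>w\<close> is \<open>0\<close>.\<close>

lemma cramer_relation:
  fixes a b c :: "'a :: comm_ring_1"
  assumes "s = a * u + b * v" "t = c * u + d * v" "w = e * u + f * v"
  shows "(a * d - c * b) * w = - (c * f - e * d) * s + (a * f - e * b) * t"
  unfolding assms by (simp add: algebra_simps)

context
  fixes q \<alpha> lam :: real and j :: nat and S :: "nat \<Rightarrow> real poly"
  assumes q: "0 < q" "q < 1" and lam: "lam > 0" and S: "sobolev_polys q \<alpha> lam j S"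
begin

lemma hermite_recurrence_fract:
  "rvar * to_fract (hermiteI q (int n))
    = to_fract (hermiteI q (int n + 1)) + rconst (hgamma q n) * to_fract (hermiteI q (int n - 1))"
  using arg_cong[OF hermiteI_recurrence[OF q, of n], of to_fract]
  by (simp only: to_fract_mult to_fract_add rconst_mult)

lemma connection:
  assumes "n \<ge> 1"
  shows "to_fract (S n) = calE1 q \<alpha> lam j n * to_fract (hermiteI q (int n))
    + calF1 q \<alpha> lam j n * to_fract (hermiteI q (int n - 1))"
proof -
  have "to_fract (S n) = to_fract (hermiteI q (int n))
      - rconst (sobc q \<alpha> lam j n) * to_fract (kernel_poly q j n \<alpha>)"
    unfolding rconst_mult using sobolev_poly_eq_kernel[OF q lam S assms] by simp
  then show ?thesis
    unfolding kernel_poly_eq_calA_calB[OF q assms]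
    by (simp add: calE1_def calF1_def algebra_simps)
qed

lemma hermiteI_lower_fract:
  assumes "n \<ge> 2"
  shows "to_fract (hermiteI q (int n - 2))
    = (rvar * to_fract (hermiteI q (int n - 1)) - to_fract (hermiteI q (int n))) / rconst (hgamma q (n - 1))"
    and "rconst (hgamma q (n - 1)) \<noteq> 0"
proof -
  obtain m where m: "n = Suc (Suc m)"
    using assms by (auto simp: numeral_2_eq_2 dest: Suc_le_D)
  show nz: "rconst (hgamma q (n - 1)) \<noteq> 0"
    using hgamma_Suc_neq_0[OF q, of m] by (simp add: m)
  have "rvar * to_fract (hermiteI q (int n - 1)) - to_fract (hermiteI q (int n))
      = rconst (hgamma q (n - 1)) * to_fract (hermiteI q (int n - 2))"
    using hermite_recurrence_fract[of "n - 1"] assms by (simp add: of_nat_diff)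
  then show "to_fract (hermiteI q (int n - 2))
      = (rvar * to_fract (hermiteI q (int n - 1)) - to_fract (hermiteI q (int n))) / rconst (hgamma q (n - 1))"
    using nz by simp
qed

lemma connection_pred:
  assumes "n \<ge> 2"
  shows "to_fract (S (n - 1)) = calE2 q \<alpha> lam j n * to_fract (hermiteI q (int n))
    + calF2 q \<alpha> lam j n * to_fract (hermiteI q (int n - 1))"
proof -
  have "int (n - 1) = int n - 1" "int (n - 1) - 1 = int n - 2"
    using assms by auto
  then have "to_fract (S (n - 1)) = calE1 q \<alpha> lam j (n - 1) * to_fract (hermiteI q (int n - 1))
      + calF1 q \<alpha> lam j (n - 1) * to_fract (hermiteI q (int n - 2))"
    using connection[of "n - 1"] assms by simp
  then show ?thesis
    unfolding hermiteI_lower_fract(1)[OF assms] calE2_def calF2_def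
    by (simp add: algebra_simps diff_divide_distrib)
qed

lemma rqderiv_hermiteI:
  "rqderiv q (to_fract (hermiteI q (int n))) = rconst (qnum q n) * to_fract (hermiteI q (int n - 1))"
  using q by (simp add: rqderiv_to_fract poly_qderiv_hermiteI rconst_mult del: to_fract_mult)

text \<open>The q-product rule evaluates the coefficients \<open>\<A>\<close> and \<open>\<B>\<close> at \<open>q x\<close> wherever \<open>D\<^sub>q\<close> falls on a
  Hermite polynomial; lowering then produces \<open>H\<^sub>n\<^sub>-\<^sub>2\<close>, which the recurrence removes.\<close>

lemma connection_qderiv:
  assumes "n \<ge> 2"
  shows "rqderiv q (to_fract (S n)) = calE3 q \<alpha> lam j n * to_fract (hermiteI q (int n))
    + calF3 q \<alpha> lam j n * to_fract (hermiteI q (int n - 1))"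
proof -
  let ?h = "to_fract (hermiteI q (int n))" and ?h1 = "to_fract (hermiteI q (int n - 1))"
  let ?h2 = "to_fract (hermiteI q (int n - 2))"
  let ?A = "calA q j n \<alpha>" and ?B = "calB q j n \<alpha>" and ?g = "rconst (hgamma q (n - 1))"
  have q0: "q \<noteq> 0"
    using q by simp
  have "to_fract (S n) = ?h + rconst (- sobc q \<alpha> lam j n) * (?A * ?h + ?B * ?h1)"
  proof -
    have "rconst (- sobc q \<alpha> lam j n) = - rconst (sobc q \<alpha> lam j n)"
      by (simp flip: to_fract_uminus)
    then show ?thesis
      using connection[of n] assms by (simp add: calE1_def calF1_def algebra_simps)
  qed
  then have "rqderiv q (to_fract (S n))
      = rqderiv q ?h + rconst (- sobc q \<alpha> lam j n)
        * ((rqderiv q ?A * ?h + rdilate q ?A * rqderiv q ?h) + (rqderiv q ?B * ?h1 + rdilate q ?B * rqderiv q ?h1))"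
    by (simp only: rqderiv_add[OF q0] rqderiv_rconst_mult[OF q0]) (simp only: rqderiv_mult[OF q0])
  also have "rqderiv q ?h = rconst (qnum q n) * ?h1"
    by (rule rqderiv_hermiteI)
  also have "rqderiv q ?h1 = rconst (qnum q (n - 1) / hgamma q (n - 1)) * (rvar * ?h1 - ?h)"
  proof -
    have "int (n - 1) = int n - 1" "int (n - 1) - 1 = int n - 2"
      using assms by auto
    then have "rqderiv q ?h1 = rconst (qnum q (n - 1)) * ?h2"
      using rqderiv_hermiteI[of "n - 1"] by simp
    moreover have "rconst (qnum q (n - 1)) = rconst (qnum q (n - 1) / hgamma q (n - 1)) * ?g"
      using hermiteI_lower_fract(2)[OF assms] by (simp flip: to_fract_mult)
    ultimately show ?thesis
      using hermiteI_lower_fract[OF assms] by simp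
  qed
  also have "rconst (- sobc q \<alpha> lam j n) = - rconst (sobc q \<alpha> lam j n)"
    by (simp flip: to_fract_uminus)
  finally show ?thesis
    by (simp add: calE3_def calF3_def calC1_def calD1_def algebra_simps)
qed

lemma connection_qderiv_succ:
  assumes "n \<ge> 1"
  shows "rqderiv q (to_fract (S (n + 1))) = calE7 q \<alpha> lam j n * to_fract (hermiteI q (int n))
    + calF7 q \<alpha> lam j n * to_fract (hermiteI q (int n - 1))"
proof -
  have d: "rqderiv q (to_fract (S (n + 1))) = calE3 q \<alpha> lam j (n + 1) * to_fract (hermiteI q (int n + 1))
      + calF3 q \<alpha> lam j (n + 1) * to_fract (hermiteI q (int n))"
    using connection_qderiv[of "n + 1"] assms by (simp add: add.commute)
  have h: "to_fract (hermiteI q (int n + 1))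
      = rvar * to_fract (hermiteI q (int n)) - rconst (hgamma q n) * to_fract (hermiteI q (int n - 1))"
    using hermite_recurrence_fract[of n] by simp
  show ?thesis
    unfolding d h calE7_def calF7_def by (simp add: algebra_simps)
qed

text \<open>Cramer's rule eliminates \<open>H\<^sub>n\<close> and \<open>H\<^sub>n\<^sub>-\<^sub>1\<close>: the q-derivatives of \<open>S\<^sub>n\<close> and of \<open>S\<^sub>n\<^sub>+\<^sub>1\<close>
  are expressed through \<open>S\<^sub>n\<close> and \<open>S\<^sub>n\<^sub>-\<^sub>1\<close> with the same determinant in front.\<close>

lemma ladder_down:
  assumes "n \<ge> 2"
  shows "Xi1 q \<alpha> lam j n * rqderiv q (to_fract (S n))
    = calE4 q \<alpha> lam j n * to_fract (S n) + calF4 q \<alpha> lam j n * to_fract (S (n - 1))"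
  unfolding Xi1_def calE4_def calF4_def
  by (rule cramer_relation[OF connection connection_pred connection_qderiv]) (use assms in auto)

lemma ladder_up:
  assumes "n \<ge> 2"
  shows "Xi1 q \<alpha> lam j n * rqderiv q (to_fract (S (n + 1)))
    = calE8 q \<alpha> lam j n * to_fract (S n) + calF8 q \<alpha> lam j n * to_fract (S (n - 1))"
  unfolding Xi1_def calE8_def calF8_def
  by (rule cramer_relation[OF connection connection_pred connection_qderiv_succ]) (use assms in auto)

end

theorem theorem1:
  fixes q \<alpha> lam :: real and j n :: nat and HH :: "nat \<Rightarrow> real poly"
  assumes "0 < q" and "q < 1"
    and "\<bar>\<alpha>\<bar> > 1"
    and "lam > 0"
    and "sobolev_polys q \<alpha> lam j HH"
    and "n \<ge> 2"
  shows "Xi2 q \<alpha> lam j n * to_fract (HH (n + 1)) =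
           alpha_coeff q \<alpha> lam j n * to_fract (HH n)
           + beta_coeff q \<alpha> lam j n * to_fract (HH (n - 1))"
proof -
  note hyps = assms(1,2,4,5)
  let ?d = "rqderiv q (to_fract (HH (n + 1)))"
  have down: "Xi1 q \<alpha> lam j (n + 1) * ?d
      = calE4 q \<alpha> lam j (n + 1) * to_fract (HH (n + 1)) + calF4 q \<alpha> lam j (n + 1) * to_fract (HH n)"
    using ladder_down[OF hyps, of "n + 1"] assms(6) by simp
  have up: "Xi1 q \<alpha> lam j n * ?d
      = calE8 q \<alpha> lam j n * to_fract (HH n) + calF8 q \<alpha> lam j n * to_fract (HH (n - 1))"
    using ladder_up[OF hyps assms(6)] .
  have "Xi2 q \<alpha> lam j n * to_fract (HH (n + 1))
      = Xi1 q \<alpha> lam j n * (Xi1 q \<alpha> lam j (n + 1) * ?d - calF4 q \<alpha> lam j (n + 1) * to_fract (HH n))"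
    by (simp only: Xi2_def down mult.assoc add_diff_cancel_right')
  also have "\<dots> = Xi1 q \<alpha> lam j (n + 1) * (Xi1 q \<alpha> lam j n * ?d)
      - Xi1 q \<alpha> lam j n * calF4 q \<alpha> lam j (n + 1) * to_fract (HH n)"
    by (simp add: right_diff_distrib mult_ac)
  also have "\<dots> = alpha_coeff q \<alpha> lam j n * to_fract (HH n)
      + beta_coeff q \<alpha> lam j n * to_fract (HH (n - 1))"
    unfolding up by (simp add: alpha_coeff_def beta_coeff_def algebra_simps)
  finally show ?thesis .
qed

end
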